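(* Let $F$ be a free group on a finite set, let $X=\{x_1,\dots,x_n\}$ be a basis of $F$ and let $w$ be an $X$-prefundamental element of $F$. Then there exists a nonnegative integer $g\le n/2$ such that $$\langle x_1,\dots,x_n\mid w\rangle\;\cong\;\Big\langle a_1,b_1,a_2,b_2,\dots,a_g,b_g\;\Big|\;\prod_{i=1}^g[a_i,b_i]\Big\rangle\star F_r,$$ where $r=n-2g$ and $F_r$ is a free group on $r$ letters.
   Context: $\star$ denotes the free product and $[x,y]=x^{-1}y^{-1}xy$. A basis of $F$ is a subset $X\subset F$ on which $F$ is free. For a basis $X$ and $w\in F$, $w_X=(w_1,\dots,w_s)$ denotes the unique reduced tuple of elements of $X\cup X^{-1}$ with $w=w_1\cdots w_s$. An element $w\in F$ is $X$-prefundamental if (1) for each $x\in X\cup X^{-1}$, if $x$ occurs in $w_X$ then $x^{-1}$ occurs in $w_X$; and (2) no element of $X\cup X^{-1}$ occurs more than once in $w_X$. $\langle X\mid w\rangle$ denotes the quotient of the free group on $X$ by the normal subgroup generated by $w$. *)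

theory Defs
  imports "HOL-Algebra.Coset"
begin

section \<open>Quotients of free monoids\<close>

inductive_set word_cong :: "'l set \<Rightarrow> ('l list \<times> 'l list) set \<Rightarrow> ('l list \<times> 'l list) set"
  for L :: "'l set" and R :: "('l list \<times> 'l list) set" where
  base: "\<lbrakk>(u, v) \<in> R; u \<in> lists L; v \<in> lists L; p \<in> lists L; q \<in> lists L\<rbrakk>
           \<Longrightarrow> (p @ u @ q, p @ v @ q) \<in> word_cong L R"
| refl: "u \<in> lists L \<Longrightarrow> (u, u) \<in> word_cong L R"
| sym: "(u, v) \<in> word_cong L R \<Longrightarrow> (v, u) \<in> word_cong L R"
| trans: "\<lbrakk>(u, v) \<in> word_cong L R; (v, w) \<in> word_cong L R\<rbrakk> \<Longrightarrow> (u, w) \<in> word_cong L R"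

definition word_quotient :: "'l set \<Rightarrow> ('l list \<times> 'l list) set \<Rightarrow> 'l list set monoid" where
  "word_quotient L R =
     \<lparr>carrier = lists L // word_cong L R,
      mult = (\<lambda>A B. \<Union>u\<in>A. \<Union>v\<in>B. word_cong L R `` {u @ v}),
      one = word_cong L R `` {[]}\<rparr>"

lemma word_cong_lists:
  assumes "(u, v) \<in> word_cong L R"
  shows "u \<in> lists L" "v \<in> lists L"
  using assms by (induction) auto

lemma equiv_word_cong: "equiv (lists L) (word_cong L R)"
proof (rule equivI)
  show "word_cong L R \<subseteq> lists L \<times> lists L" by (auto dest: word_cong_lists)
  show "refl_on (lists L) (word_cong L R)" by (rule refl_onI) (rule word_cong.refl)
  show "Relation.sym (word_cong L R)" by (rule symI) (rule word_cong.sym)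
  show "Relation.trans (word_cong L R)" by (rule transI) (rule word_cong.trans)
qed

lemma word_cong_context:
  assumes "(u, v) \<in> word_cong L R" "p \<in> lists L" "q \<in> lists L"
  shows "(p @ u @ q, p @ v @ q) \<in> word_cong L R"
  using assms
proof (induction)
  case (base u v p' q')
  then have "((p @ p') @ u @ (q' @ q), (p @ p') @ v @ (q' @ q)) \<in> word_cong L R"
    by (intro word_cong.base) auto
  then show ?case by simp
next
  case (refl u)
  then show ?case by (intro word_cong.refl) auto
next
  case (sym u v)
  then show ?case by (blast intro: word_cong.sym)
next
  case (trans u v w)
  show ?case by (rule word_cong.trans[OF trans.IH(1,2)]) (fact trans.prems)+
qed

lemma word_cong_append:
  assumes "(u, u') \<in> word_cong L R" "(v, v') \<in> word_cong L R"
  shows "(u @ v, u' @ v') \<in> word_cong L R"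
proof -
  have "(u @ v, u' @ v) \<in> word_cong L R"
    using word_cong_context[OF assms(1), of "[]" v] word_cong_lists[OF assms(2)] by simp
  moreover have "(u' @ v, u' @ v') \<in> word_cong L R"
    using word_cong_context[OF assms(2), of u' "[]"] word_cong_lists[OF assms(1)] by simp
  ultimately show ?thesis by (rule word_cong.trans)
qed

lemma carrier_word_quotient: "carrier (word_quotient L R) = (\<lambda>u. word_cong L R `` {u}) ` lists L"
  by (auto simp: word_quotient_def quotient_def)

lemma one_word_quotient: "\<one>\<^bsub>word_quotient L R\<^esub> = word_cong L R `` {[]}"
  by (simp add: word_quotient_def)

lemma mult_word_quotient:
  assumes "u \<in> lists L" "v \<in> lists L"
  shows "word_cong L R `` {u} \<otimes>\<^bsub>word_quotient L R\<^esub> word_cong L R `` {v} = word_cong L R `` {u @ v}"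
proof -
  have "congruent2 (word_cong L R) (word_cong L R) (\<lambda>u v. word_cong L R `` {u @ v})"
    unfolding congruent2_def
    by (auto intro!: equiv_class_eq[OF equiv_word_cong] word_cong_append)
  from UN_equiv_class2[OF equiv_word_cong equiv_word_cong this assms]
  show ?thesis by (simp add: word_quotient_def)
qed

lemma word_class_eq_iff:
  assumes "u \<in> lists L" "v \<in> lists L"
  shows "word_cong L R `` {u} = word_cong L R `` {v} \<longleftrightarrow> (u, v) \<in> word_cong L R"
  using eq_equiv_class_iff[OF equiv_word_cong assms] .

lemma monoid_word_quotient: "Group.monoid (word_quotient L R)"
proof (rule monoidI)
  let ?Q = "word_quotient L R" and ?c = "\<lambda>u. word_cong L R `` {u}"
  have mult: "?c u \<otimes>\<^bsub>?Q\<^esub> ?c v = ?c (u @ v)" if "u \<in> lists L" "v \<in> lists L" for u v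
    using that by (rule mult_word_quotient)
  show "\<one>\<^bsub>?Q\<^esub> \<in> carrier ?Q"
    unfolding one_word_quotient carrier_word_quotient by (rule imageI) (rule lists.Nil)
  fix a b c assume "a \<in> carrier ?Q" "b \<in> carrier ?Q" "c \<in> carrier ?Q"
  then obtain u v w where uvw: "u \<in> lists L" "v \<in> lists L" "w \<in> lists L"
    "a = ?c u" "b = ?c v" "c = ?c w"
    unfolding carrier_word_quotient by (elim imageE)
  then have uv: "u @ v \<in> lists L" and vw: "v @ w \<in> lists L" by auto
  show "a \<otimes>\<^bsub>?Q\<^esub> b \<in> carrier ?Q"
    unfolding uvw mult[OF uvw(1,2)] carrier_word_quotient using uv by (rule imageI)
  show "a \<otimes>\<^bsub>?Q\<^esub> b \<otimes>\<^bsub>?Q\<^esub> c = a \<otimes>\<^bsub>?Q\<^esub> (b \<otimes>\<^bsub>?Q\<^esub> c)"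
    unfolding uvw mult[OF uvw(1,2)] mult[OF uvw(2,3)] mult[OF uv uvw(3)] mult[OF uvw(1) vw]
    by (simp only: append_assoc)
next
  let ?Q = "word_quotient L R" and ?c = "\<lambda>u. word_cong L R `` {u}"
  fix a assume "a \<in> carrier ?Q"
  then obtain u where u: "u \<in> lists L" "a = ?c u"
    unfolding carrier_word_quotient by (elim imageE)
  show "\<one>\<^bsub>?Q\<^esub> \<otimes>\<^bsub>?Q\<^esub> a = a" "a \<otimes>\<^bsub>?Q\<^esub> \<one>\<^bsub>?Q\<^esub> = a"
    unfolding u one_word_quotient
      mult_word_quotient[OF lists.Nil u(1)] mult_word_quotient[OF u(1) lists.Nil]
    by simp_all
qed

lemma group_word_quotient:
  assumes "\<And>x. x \<in> L \<Longrightarrow> \<exists>y\<in>L. ([y, x], []) \<in> word_cong L R"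
  shows "group (word_quotient L R)"
proof -
  have inv: "\<exists>v\<in>lists L. (v @ u, []) \<in> word_cong L R" if "u \<in> lists L" for u
    using that
  proof (induction u)
    case Nil
    then show ?case by (intro bexI[of _ "[]"]) (auto intro: word_cong.refl)
  next
    case (Cons x u)
    then obtain v where v: "v \<in> lists L" "(v @ u, []) \<in> word_cong L R" by auto
    from Cons.hyps assms obtain y where y: "y \<in> L" "([y, x], []) \<in> word_cong L R" by auto
    have "(v @ [y, x] @ u, v @ [] @ u) \<in> word_cong L R"
      using word_cong_context[OF y(2) v(1)] Cons by auto
    then have "((v @ [y]) @ x # u, []) \<in> word_cong L R"
      using v word_cong.trans by fastforce
    then show ?case using v y by (intro bexI[of _ "v @ [y]"]) auto
  qed
  show ?thesis
  proof (rule groupI)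
    fix A assume "A \<in> carrier (word_quotient L R)"
    then obtain u where u: "u \<in> lists L" "A = word_cong L R `` {u}"
      by (auto simp: carrier_word_quotient)
    with inv obtain v where v: "v \<in> lists L" "(v @ u, []) \<in> word_cong L R" by blast
    with u have "word_cong L R `` {v} \<otimes>\<^bsub>word_quotient L R\<^esub> A = \<one>\<^bsub>word_quotient L R\<^esub>"
      by (simp add: one_word_quotient mult_word_quotient word_class_eq_iff)
    with v show "\<exists>B\<in>carrier (word_quotient L R). B \<otimes>\<^bsub>word_quotient L R\<^esub> A = \<one>\<^bsub>word_quotient L R\<^esub>"
      by (auto simp: carrier_word_quotient)
  qed (use monoid_word_quotient[of L R] in \<open>simp_all add: Group.monoid.m_closed
        Group.monoid.one_closed Group.monoid.m_assoc Group.monoid.l_one\<close>)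
qed


section \<open>Free groups and bases\<close>

text \<open>A letter \<open>(x, True)\<close> stands for the generator \<open>x\<close>, and \<open>(x, False)\<close> for its formal inverse.\<close>

definition free_group :: "'a set \<Rightarrow> ('a \<times> bool) list set monoid" where
  "free_group S = word_quotient (S \<times> UNIV) {([(x, b), (x, \<not> b)], []) | x b. x \<in> S}"

definition free_gen :: "'a set \<Rightarrow> 'a \<Rightarrow> ('a \<times> bool) list set" where
  "free_gen S x =
     word_cong (S \<times> UNIV) {([(x, b), (x, \<not> b)], []) | x b. x \<in> S} `` {[(x, True)]}"

lemma group_free_group: "group (free_group S)"
  unfolding free_group_def
proof (rule group_word_quotient)
  let ?R = "{([(x, b), (x, \<not> b)], []) | x b. x \<in> S}"
  fix l :: "'a \<times> bool" assume "l \<in> S \<times> UNIV"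
  then obtain x b where l: "l = (x, b)" "x \<in> S" by auto
  then have "([] @ [(x, \<not> b), (x, \<not> (\<not> b))] @ [], [] @ [] @ []) \<in> word_cong (S \<times> UNIV) ?R"
    by (intro word_cong.base; (blast | simp))
  with l show "\<exists>y\<in>S \<times> UNIV. ([y, l], []) \<in> word_cong (S \<times> UNIV) ?R"
    by (intro bexI[of _ "(x, \<not> b)"]) auto
qed

lemma free_gen_closed: "x \<in> S \<Longrightarrow> free_gen S x \<in> carrier (free_group S)"
  by (auto simp: free_gen_def free_group_def carrier_word_quotient)

text \<open>\<open>F\<close> is free on \<open>X\<close>: the canonical map from the free group on the set \<open>X\<close> to \<open>F\<close>
  is an isomorphism.\<close>

definition basis :: "('a, 'm) monoid_scheme \<Rightarrow> 'a set \<Rightarrow> bool" where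
  "basis F X \<longleftrightarrow> X \<subseteq> carrier F \<and> (\<exists>\<phi>\<in>iso (free_group X) F. \<forall>x\<in>X. \<phi> (free_gen X x) = x)"


section \<open>Prefundamental elements\<close>

definition reduced_tuple :: "('a, 'm) monoid_scheme \<Rightarrow> 'a set \<Rightarrow> 'a list \<Rightarrow> bool" where
  "reduced_tuple F X ws \<longleftrightarrow>
     set ws \<subseteq> X \<union> m_inv F ` X \<and>
     (\<forall>i. Suc i < length ws \<longrightarrow> ws ! Suc i \<noteq> inv\<^bsub>F\<^esub> (ws ! i))"

definition list_prod :: "('a, 'm) monoid_scheme \<Rightarrow> 'a list \<Rightarrow> 'a" where
  "list_prod G ws = foldr (mult G) ws \<one>\<^bsub>G\<^esub>"

definition reduced_form :: "('a, 'm) monoid_scheme \<Rightarrow> 'a set \<Rightarrow> 'a \<Rightarrow> 'a list" where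
  "reduced_form F X w = (THE ws. reduced_tuple F X ws \<and> list_prod F ws = w)"

definition prefundamental :: "('a, 'm) monoid_scheme \<Rightarrow> 'a set \<Rightarrow> 'a \<Rightarrow> bool" where
  "prefundamental F X w \<longleftrightarrow>
     w \<in> carrier F \<and>
     (\<forall>x\<in>X \<union> m_inv F ` X. x \<in> set (reduced_form F X w) \<longrightarrow> inv\<^bsub>F\<^esub> x \<in> set (reduced_form F X w)) \<and>
     distinct (reduced_form F X w)"


section \<open>Presentations, surface groups and free products\<close>

definition normal_closure :: "('a, 'm) monoid_scheme \<Rightarrow> 'a set \<Rightarrow> 'a set" where
  "normal_closure G R = \<Inter>{N. N \<lhd> G \<and> R \<subseteq> N}"

lemma (in group) normal_closure_normal:
  assumes "R \<subseteq> carrier G"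
  shows "normal_closure G R \<lhd> G"
proof -
  have "carrier G \<lhd> G"
    by (rule normal_invI[OF subgroup_self]) auto
  then have ne: "{N. N \<lhd> G \<and> R \<subseteq> N} \<noteq> {}" using assms by blast
  show ?thesis
    unfolding normal_closure_def
  proof (rule normal_invI)
    show "subgroup (\<Inter>{N. N \<lhd> G \<and> R \<subseteq> N}) G"
      using ne by (intro subgroups_Inter) (auto dest: normal_imp_subgroup)
  qed (auto intro: normal.inv_op_closed2)
qed

definition comm_elt :: "('a, 'm) monoid_scheme \<Rightarrow> 'a \<Rightarrow> 'a \<Rightarrow> 'a" where
  "comm_elt G x y = inv\<^bsub>G\<^esub> x \<otimes>\<^bsub>G\<^esub> inv\<^bsub>G\<^esub> y \<otimes>\<^bsub>G\<^esub> x \<otimes>\<^bsub>G\<^esub> y"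

datatype surface_letter = A nat | B nat

definition surface_letters :: "nat \<Rightarrow> surface_letter set" where
  "surface_letters g = A ` {1..g} \<union> B ` {1..g}"

definition surface_relator :: "nat \<Rightarrow> (surface_letter \<times> bool) list set" where
  "surface_relator g =
     (let S = surface_letters g; F = free_group S
      in list_prod F (map (\<lambda>i. comm_elt F (free_gen S (A i)) (free_gen S (B i))) [1..<Suc g]))"

definition surface_group :: "nat \<Rightarrow> (surface_letter \<times> bool) list set set monoid" where
  "surface_group g =
     free_group (surface_letters g) Mod
       normal_closure (free_group (surface_letters g)) {surface_relator g}"

text \<open>The free product consists of words in the disjoint union of the carriers, modulo
  multiplying out adjacent letters from the same factor and deleting identity letters.\<close>

definition free_product_rel ::
  "('a, 'm) monoid_scheme \<Rightarrow> ('b, 'n) monoid_scheme \<Rightarrow> (('a + 'b) list \<times> ('a + 'b) list) set" where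
  "free_product_rel G H =
     {([Inl x, Inl y], [Inl (x \<otimes>\<^bsub>G\<^esub> y)]) | x y. x \<in> carrier G \<and> y \<in> carrier G} \<union>
     {([Inr x, Inr y], [Inr (x \<otimes>\<^bsub>H\<^esub> y)]) | x y. x \<in> carrier H \<and> y \<in> carrier H} \<union>
     {([Inl \<one>\<^bsub>G\<^esub>], []), ([Inr \<one>\<^bsub>H\<^esub>], [])}"

definition free_product ::
  "('a, 'm) monoid_scheme \<Rightarrow> ('b, 'n) monoid_scheme \<Rightarrow> ('a + 'b) list set monoid"
  (infixr "\<star>" 70) where
  "G \<star> H = word_quotient (carrier G <+> carrier H) (free_product_rel G H)"

lemma group_free_product:
  assumes "group G" "group H"
  shows "group (G \<star> H)"
  unfolding free_product_def
proof (rule group_word_quotient)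
  interpret G: group G by fact
  interpret H: group H by fact
  let ?L = "carrier G <+> carrier H" and ?R = "free_product_rel G H"
  have step: "(u, v) \<in> word_cong ?L ?R" if "(u, v) \<in> ?R" "u \<in> lists ?L" "v \<in> lists ?L" for u v
    using word_cong.base[OF that, of "[]" "[]"] by simp
  fix l assume "l \<in> ?L"
  then consider x where "l = Inl x" "x \<in> carrier G" | x where "l = Inr x" "x \<in> carrier H" by auto
  then show "\<exists>y\<in>?L. ([y, l], []) \<in> word_cong ?L ?R"
  proof cases
    case 1
    have "([Inl (inv\<^bsub>G\<^esub> x), Inl x], [Inl (inv\<^bsub>G\<^esub> x \<otimes>\<^bsub>G\<^esub> x)]) \<in> word_cong ?L ?R"
      using 1 by (intro step) (auto simp: free_product_rel_def)
    moreover have "([Inl \<one>\<^bsub>G\<^esub>], []) \<in> word_cong ?L ?R"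
      by (intro step) (auto simp: free_product_rel_def)
    ultimately have "([Inl (inv\<^bsub>G\<^esub> x), Inl x], []) \<in> word_cong ?L ?R"
      using 1 by (auto intro: word_cong.trans)
    with 1 show ?thesis by (intro bexI[of _ "Inl (inv\<^bsub>G\<^esub> x)"]) auto
  next
    case 2
    have "([Inr (inv\<^bsub>H\<^esub> x), Inr x], [Inr (inv\<^bsub>H\<^esub> x \<otimes>\<^bsub>H\<^esub> x)]) \<in> word_cong ?L ?R"
      using 2 by (intro step) (auto simp: free_product_rel_def)
    moreover have "([Inr \<one>\<^bsub>H\<^esub>], []) \<in> word_cong ?L ?R"
      by (intro step) (auto simp: free_product_rel_def)
    ultimately have "([Inr (inv\<^bsub>H\<^esub> x), Inr x], []) \<in> word_cong ?L ?R"
      using 2 by (auto intro: word_cong.trans)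
    with 2 show ?thesis by (intro bexI[of _ "Inr (inv\<^bsub>H\<^esub> x)"]) auto
  qed
qed

end

theory Submission
  imports Defs "HOL-Algebra.Generated_Groups"
begin

text \<open>
  Topologically, \<open>w\<close> prescribes how the sides of a polygon are glued in pairs. Since the two sides that
  belong to a generator occur with opposite signs, the result is an orientable surface in which, besides,
  some corners of the polygon may have been identified. The surface accounts for the surface group. The
  identifications of corners and the unused generators account for the free factor.

  The proof follows the algebraic classification of such gluings. As \<open>w\<close> is prefundamental, it is the
  value of a word in which every generator that occurs does so once with each sign
  (\<open>prefundamental_quadratic_word\<close>). This rests on the uniqueness of reduced words in a free group. In
  such a word either two adjacent letters cancel or two pairs of letters are linked, that is, the word
  has the form \<open>e x a y b x\<^sup>-\<^sup>1 c y\<^sup>-\<^sup>1 d\<close> (\<open>quadratic_cases\<close>). In the linked case the value of the word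
  equals \<open>[x', y'] e c b a d\<close>, where \<open>x'\<close> arises from \<open>x\<close> or its inverse by multiplication on both sides with words
  that involve neither \<open>x\<close> nor \<open>y\<close>, and likewise \<open>y'\<close> from \<open>y\<close>. Therefore some automorphism of \<open>F\<close> maps
  \<open>x\<close> to \<open>x'\<close> and \<open>y\<close> to \<open>y'\<close> and fixes the other generators (\<open>split_off_commutator\<close>), and the shorter word
  \<open>e c b a d\<close> is again of the same kind. Induction on the length yields an automorphism of \<open>F\<close> that maps a product
  of commutators of \<open>2 g\<close> distinct basis elements to \<open>w\<close> (\<open>quadratic_word_comm_prod\<close>).

  Applying an automorphism to the relator does not change the isomorphism type of the quotient (\<open>quotient_iso\<close>),
  so \<open>w\<close> may be replaced by that product of commutators. The remaining \<open>n - 2 g\<close> basis elements are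
  then free of relations, and the universal properties of free groups, quotients and free products
  identify the quotient with the free product (\<open>comm_prod_quotient\<close>).
\<close>

section \<open>Homomorphisms and generators\<close>

lemma list_prod_simps [simp]:
  "list_prod G [] = \<one>\<^bsub>G\<^esub>" "list_prod G (x # xs) = x \<otimes>\<^bsub>G\<^esub> list_prod G xs"
  by (simp_all add: list_prod_def)

lemma (in monoid) list_prod_closed [simp]:
  "set xs \<subseteq> carrier G \<Longrightarrow> list_prod G xs \<in> carrier G"
  by (induction xs) auto

lemma (in monoid) list_prod_append:
  "set xs \<subseteq> carrier G \<Longrightarrow> set ys \<subseteq> carrier G \<Longrightarrow>
    list_prod G (xs @ ys) = list_prod G xs \<otimes> list_prod G ys"
  by (induction xs) (auto simp: m_assoc)

lemma (in group_hom) hom_comm_elt: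
  "x \<in> carrier G \<Longrightarrow> y \<in> carrier G \<Longrightarrow> h (comm_elt G x y) = comm_elt H (h x) (h y)"
  by (simp add: comm_elt_def)

lemma (in group) comm_elt_closed [simp]:
  "x \<in> carrier G \<Longrightarrow> y \<in> carrier G \<Longrightarrow> comm_elt G x y \<in> carrier G"
  by (simp add: comm_elt_def)

lemma group_hom_compose:
  assumes "group_hom G H f" "group_hom H K g"
  shows "group_hom G K (\<lambda>x. g (f x))"
  using assms hom_compose[of f G H g K] by (simp add: group_hom_def group_hom_axioms_def o_def)

lemma group_hom_id: "group G \<Longrightarrow> group_hom G G (\<lambda>x. x)"
  by (simp add: group_hom_def group_hom_axioms_def hom_def Pi_def)

lemma hom_eq_on_generate:
  assumes "group_hom G H h" "group_hom G H k" "Y \<subseteq> carrier G"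
    and "\<And>a. a \<in> Y \<Longrightarrow> h a = k a" "x \<in> generate G Y"
  shows "h x = k x"
proof -
  interpret h: group_hom G H h by fact
  interpret k: group_hom G H k by fact
  show ?thesis using assms(5)
  proof induction
    case (eng x y)
    then show ?case using h.G.generate_in_carrier[OF assms(3)] by simp
  qed (use assms in auto)
qed

text \<open>All isomorphisms below are obtained in this way: a universal property yields a homomorphism in each
  direction, and it remains to follow the generators around.\<close>

lemma iso_by_generators:
  assumes "group_hom G H f" "group_hom H G g"
    and "generate G Y = carrier G" "generate H Z = carrier H"
    and "\<And>a. a \<in> Y \<Longrightarrow> g (f a) = a" "\<And>b. b \<in> Z \<Longrightarrow> f (g b) = b"
  shows "f \<in> iso G H"
proof -
  interpret f: group_hom G H f by fact
  interpret g: group_hom H G g by fact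
  have Y: "Y \<subseteq> carrier G" and Z: "Z \<subseteq> carrier H"
    using generate.incl[of _ Y G] generate.incl[of _ Z H] assms(3,4) by auto
  note gf = group_hom_compose[OF assms(1,2)] and fg = group_hom_compose[OF assms(2,1)]
  have "g (f x) = x" if "x \<in> carrier G" for x
    using hom_eq_on_generate[OF gf group_hom_id[OF f.G.group_axioms] Y] assms(3,5) that by auto
  moreover have "f (g x) = x" if "x \<in> carrier H" for x
    using hom_eq_on_generate[OF fg group_hom_id[OF f.H.group_axioms] Z] assms(4,6) that by auto
  ultimately show ?thesis
    by (intro group_isomorphisms_imp_iso[where g = g])
      (auto simp: group_isomorphisms_def f.homh g.homh)
qed

text \<open>Free groups and free products are both quotients of free monoids, so this single statement gives
  the universal property of each: evaluation in \<open>K\<close> respects the congruence as soon as it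
  respects the defining pairs.\<close>

lemma word_quotient_hom:
  assumes "Group.monoid K" "f \<in> L \<rightarrow> carrier K"
    and rel: "\<And>u v. (u, v) \<in> R \<Longrightarrow> u \<in> lists L \<Longrightarrow> v \<in> lists L \<Longrightarrow>
      list_prod K (map f u) = list_prod K (map f v)"
  obtains h where "h \<in> hom (word_quotient L R) K"
    and "\<And>u. u \<in> lists L \<Longrightarrow> h (word_cong L R `` {u}) = list_prod K (map f u)"
proof -
  interpret K: Group.monoid K by fact
  let ?val = "\<lambda>u. list_prod K (map f u)"
  have cl: "set (map f u) \<subseteq> carrier K" if "u \<in> lists L" for u
    using that assms(2) by auto
  have val_append: "?val (u @ v) = ?val u \<otimes>\<^bsub>K\<^esub> ?val v" if "u \<in> lists L" "v \<in> lists L" for u v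
    using K.list_prod_append[OF cl cl] that by simp
  have cong: "?val u = ?val v" if "(u, v) \<in> word_cong L R" for u v
    using that
  proof induction
    case (base u v p q)
    then show ?case using rel[of u v]
      by (simp only: val_append append_in_lists_conv)
  qed auto
  \<comment> \<open>Evaluation is constant on classes, so any representative may be evaluated.\<close>
  define h where "h = (\<lambda>C. ?val (SOME u. u \<in> C))"
  have h: "h (word_cong L R `` {u}) = ?val u" if "u \<in> lists L" for u
  proof -
    have "u \<in> word_cong L R `` {u}" using word_cong.refl[OF that] by simp
    then have "(SOME v. v \<in> word_cong L R `` {u}) \<in> word_cong L R `` {u}" by (rule someI)
    then show ?thesis unfolding h_def using cong by auto
  qed
  have "h \<in> hom (word_quotient L R) K"
  proof (rule homI)
    fix a assume "a \<in> carrier (word_quotient L R)"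
    then obtain u where "u \<in> lists L" "a = word_cong L R `` {u}"
      unfolding carrier_word_quotient by (elim imageE)
    then show "h a \<in> carrier K" using K.list_prod_closed[OF cl] by (simp only: h)
  next
    fix a b assume "a \<in> carrier (word_quotient L R)" "b \<in> carrier (word_quotient L R)"
    then obtain u v where "u \<in> lists L" "v \<in> lists L"
      "a = word_cong L R `` {u}" "b = word_cong L R `` {v}"
      unfolding carrier_word_quotient by (elim imageE)
    moreover from this have "u @ v \<in> lists L" by simp
    ultimately show "h (a \<otimes>\<^bsub>word_quotient L R\<^esub> b) = h a \<otimes>\<^bsub>K\<^esub> h b"
      using h val_append mult_word_quotient[of u L v R] by metis
  qed
  then show thesis using h that by blast
qed

lemma generate_word_quotient:
  assumes "group (word_quotient L R)"
    and "\<And>l. l \<in> L \<Longrightarrow> word_cong L R `` {[l]} \<in> generate (word_quotient L R) Y"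
    and "Y \<subseteq> carrier (word_quotient L R)"
  shows "generate (word_quotient L R) Y = carrier (word_quotient L R)"
proof
  show "generate (word_quotient L R) Y \<subseteq> carrier (word_quotient L R)"
    using group.generate_incl[OF assms(1,3)] .
  have "word_cong L R `` {u} \<in> generate (word_quotient L R) Y" if "u \<in> lists L" for u
    using that
  proof induction
    case Nil
    then show ?case using generate.one[of "word_quotient L R" Y] by (simp add: one_word_quotient)
  next
    case (Cons l u)
    have "[l] \<in> lists L" using Cons by simp
    from generate.eng[OF assms(2)[OF Cons.hyps(1)] Cons.IH] show ?case
      using Cons.hyps mult_word_quotient[OF \<open>[l] \<in> lists L\<close> Cons.hyps(2), of R] by simp
  qed
  then show "carrier (word_quotient L R) \<subseteq> generate (word_quotient L R) Y"
    unfolding carrier_word_quotient by blast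
qed

section \<open>Words and bases\<close>

text \<open>In a group whose elements are used as letters, the letter \<open>(x, True)\<close> is read as \<open>x\<close> and
  \<open>(x, False)\<close> as its inverse. Working with such words, rather than with tuples of group elements,
  keeps a letter and its inverse formally distinct.\<close>

definition literal :: "('a, 'm) monoid_scheme \<Rightarrow> 'a \<times> bool \<Rightarrow> 'a" where
  "literal G l = (if snd l then fst l else inv\<^bsub>G\<^esub> (fst l))"

definition word_val :: "('a, 'm) monoid_scheme \<Rightarrow> ('a \<times> bool) list \<Rightarrow> 'a" where
  "word_val G u = list_prod G (map (literal G) u)"

definition flip :: "'a \<times> bool \<Rightarrow> 'a \<times> bool" where
  "flip l = (fst l, \<not> snd l)"

lemma flip_simps [simp]:
  "flip (flip l) = l" "fst (flip l) = fst l" "flip l \<noteq> l" "l \<noteq> flip l"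
  "flip l = flip m \<longleftrightarrow> l = m" "flip (x, b) = (x, \<not> b)"
  by (cases l; cases m; auto simp: flip_def)+

lemma (in group) literal_closed [simp]: "fst l \<in> carrier G \<Longrightarrow> literal G l \<in> carrier G"
  by (simp add: literal_def)

lemma (in group) literal_flip: "fst l \<in> carrier G \<Longrightarrow> literal G (flip l) = inv (literal G l)"
  by (simp add: literal_def flip_def)

lemma word_val_simps [simp]:
  "word_val G [] = \<one>\<^bsub>G\<^esub>" "word_val G (l # u) = literal G l \<otimes>\<^bsub>G\<^esub> word_val G u"
  by (simp_all add: word_val_def)

lemma (in group) word_val_closed [simp]: "set u \<subseteq> carrier G \<times> UNIV \<Longrightarrow> word_val G u \<in> carrier G"
  by (induction u) auto

lemma (in group) word_val_append [simp]:
  "set u \<subseteq> carrier G \<times> UNIV \<Longrightarrow> set v \<subseteq> carrier G \<times> UNIV \<Longrightarrow>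
    word_val G (u @ v) = word_val G u \<otimes> word_val G v"
  by (induction u) (auto simp: m_assoc)

lemma (in group) word_val_in_generate:
  "set u \<subseteq> Y \<times> UNIV \<Longrightarrow> word_val G u \<in> generate G Y"
proof (induction u)
  case (Cons l u)
  then have "literal G l \<in> generate G Y"
    by (auto simp: literal_def intro: generate.incl generate.inv)
  with Cons show ?case by (auto intro: generate.eng)
qed (simp add: generate.one)

lemma (in group_hom) hom_word_val:
  "set u \<subseteq> carrier G \<times> UNIV \<Longrightarrow> h (word_val G u) = word_val H (map (apfst h) u)"
  by (induction u) (auto simp: literal_def)

abbreviation free_cancel :: "'a set \<Rightarrow> (('a \<times> bool) list \<times> ('a \<times> bool) list) set" where
  "free_cancel S \<equiv> {([(x, b), (x, \<not> b)], []) | x b. x \<in> S}"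

abbreviation free_cong :: "'a set \<Rightarrow> (('a \<times> bool) list \<times> ('a \<times> bool) list) set" where
  "free_cong S \<equiv> word_cong (S \<times> UNIV) (free_cancel S)"

lemma free_group_hom:
  assumes "group K" "f \<in> S \<rightarrow> carrier K"
  obtains h where "group_hom (free_group S) K h" "\<And>x. x \<in> S \<Longrightarrow> h (free_gen S x) = f x"
proof -
  interpret K: group K by fact
  have f: "f x \<in> carrier K" if "x \<in> S" for x using assms(2) that by auto
  obtain h where h: "h \<in> hom (word_quotient (S \<times> UNIV) (free_cancel S)) K"
    "\<And>u. u \<in> lists (S \<times> UNIV) \<Longrightarrow>
      h (free_cong S `` {u}) = list_prod K (map (\<lambda>l. literal K (apfst f l)) u)"
  proof (rule word_quotient_hom[of K "\<lambda>l. literal K (apfst f l)" "S \<times> UNIV" "free_cancel S"])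
    show "Group.monoid K" by unfold_locales
  qed (use f in \<open>auto simp: literal_def\<close>)
  show thesis
  proof (rule that)
    show "group_hom (free_group S) K h"
      using h(1) group_free_group assms(1)
      by (simp add: free_group_def group_hom_def group_hom_axioms_def)
    show "h (free_gen S x) = f x" if "x \<in> S" for x
      using h(2)[of "[(x, True)]"] that f by (simp add: free_gen_def literal_def)
  qed
qed

lemma free_cong_cancel: "x \<in> S \<Longrightarrow> ([(x, b), (x, \<not> b)], []) \<in> free_cong S"
  using word_cong.base[of "[(x, b), (x, \<not> b)]" "[]" "free_cancel S" "S \<times> UNIV" "[]" "[]"] by auto

lemma free_class_literal:
  assumes "l \<in> S \<times> UNIV"
  shows "free_cong S `` {[l]} = literal (free_group S) (apfst (free_gen S) l)"
proof -
  interpret group "free_group S" by (rule group_free_group)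
  obtain x b where l: "l = (x, b)" "x \<in> S" using assms by auto
  have "free_cong S `` {[(x, False)]} = inv\<^bsub>free_group S\<^esub> free_gen S x"
  proof (rule inv_equality[symmetric])
    show "free_cong S `` {[(x, False)]} \<otimes>\<^bsub>free_group S\<^esub> free_gen S x = \<one>\<^bsub>free_group S\<^esub>"
      using free_cong_cancel[OF l(2), of False] l(2)
      by (simp add: free_gen_def free_group_def mult_word_quotient one_word_quotient word_class_eq_iff)
    show "free_cong S `` {[(x, False)]} \<in> carrier (free_group S)"
      using l by (auto simp: free_group_def carrier_word_quotient)
  qed (rule free_gen_closed[OF l(2)])
  with l show ?thesis by (cases b) (auto simp: literal_def free_gen_def)
qed

text \<open>This turns statements about classes of words into statements about products, which every
  homomorphism respects.\<close>

lemma free_class_word_val: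
  assumes "set u \<subseteq> S \<times> UNIV"
  shows "free_cong S `` {u} = word_val (free_group S) (map (apfst (free_gen S)) u)"
  using assms
proof (induction u)
  case Nil
  then show ?case by (simp add: free_group_def one_word_quotient)
next
  case (Cons l u)
  then have "[l] \<in> lists (S \<times> UNIV)" "u \<in> lists (S \<times> UNIV)" by auto
  from mult_word_quotient[OF this, of "free_cancel S"] show ?case
    using Cons free_class_literal[of l S] by (simp add: free_group_def)
qed

lemma generate_free_group: "generate (free_group S) (free_gen S ` S) = carrier (free_group S)"
  unfolding free_group_def
proof (rule generate_word_quotient)
  fix l :: "'a \<times> bool" assume l: "l \<in> S \<times> UNIV"
  show "free_cong S `` {[l]} \<in> generate (word_quotient (S \<times> UNIV) (free_cancel S)) (free_gen S ` S)"
    using l unfolding free_class_literal[OF l]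
    by (auto simp: literal_def free_group_def intro: generate.intros)
qed (use group_free_group[of S] free_gen_closed[of _ S] in \<open>auto simp: free_group_def\<close>)

lemma basis_generates:
  assumes "group F" "basis F X"
  shows "generate F X = carrier F"
proof -
  obtain \<phi> where \<phi>: "\<phi> \<in> iso (free_group X) F" "\<And>x. x \<in> X \<Longrightarrow> \<phi> (free_gen X x) = x"
    using assms(2) unfolding basis_def by blast
  interpret group_hom "free_group X" F \<phi>
    using assms(1) \<phi>(1) group_free_group by (simp add: group_hom_def group_hom_axioms_def iso_def)
  have "\<phi> ` free_gen X ` X = X" using \<phi>(2) by force
  moreover have "free_gen X ` X \<subseteq> carrier (free_group X)" using free_gen_closed[of _ X] by blast
  ultimately have "generate F X = \<phi> ` generate (free_group X) (free_gen X ` X)"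
    using generate_img[of "free_gen X ` X"] by metis
  also have "\<dots> = \<phi> ` carrier (free_group X)" by (simp only: generate_free_group)
  also have "\<dots> = carrier F" using \<phi>(1) by (simp add: iso_def bij_betw_def)
  finally show ?thesis .
qed

text \<open>The universal property of a free group, transported along the isomorphism that defines a basis.\<close>

lemma basis_hom:
  assumes "group F" "basis F X" "group K" "f \<in> X \<rightarrow> carrier K"
  obtains h where "group_hom F K h" "\<And>x. x \<in> X \<Longrightarrow> h x = f x"
proof -
  obtain \<phi> where \<phi>: "\<phi> \<in> iso (free_group X) F" "\<And>x. x \<in> X \<Longrightarrow> \<phi> (free_gen X x) = x"
    using assms(2) unfolding basis_def by blast
  let ?\<psi> = "inv_into (carrier (free_group X)) \<phi>"
  have \<psi>: "?\<psi> \<in> hom F (free_group X)"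
    using group.iso_set_sym[OF group_free_group \<phi>(1)] by (simp add: iso_def)
  obtain h where h: "group_hom (free_group X) K h" "\<And>x. x \<in> X \<Longrightarrow> h (free_gen X x) = f x"
    using free_group_hom[OF assms(3,4)] by blast
  show thesis
  proof (rule that)
    show "group_hom F K (h \<circ> ?\<psi>)"
      using h(1) \<psi> assms(1,3) by (auto simp: group_hom_def group_hom_axioms_def intro: hom_compose)
    show "(h \<circ> ?\<psi>) x = f x" if "x \<in> X" for x
    proof -
      have "?\<psi> (\<phi> (free_gen X x)) = free_gen X x"
        using \<phi>(1) that by (intro inv_into_f_f) (auto simp: iso_iff free_gen_closed)
      then show ?thesis using that \<phi>(2) h(2) by simp
    qed
  qed
qed

section \<open>Reduced words\<close>

text \<open>The value of a word in a free group determines its reduced form. The classical argument lets the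
  letters act on reduced words: \<open>reduce_cons l\<close> multiplies a reduced word by \<open>l\<close> on the left, and it is
  inverse to \<open>reduce_cons (flip l)\<close>. Hence the result of letting a word act on the empty word depends
  only on the class of the word.\<close>

fun reduce_cons :: "'a \<times> bool \<Rightarrow> ('a \<times> bool) list \<Rightarrow> ('a \<times> bool) list" where
  "reduce_cons l [] = [l]"
| "reduce_cons l (m # u) = (if m = flip l then u else l # m # u)"

definition free_reduce :: "('a \<times> bool) list \<Rightarrow> ('a \<times> bool) list" where
  "free_reduce u = foldr reduce_cons u []"

abbreviation reduced_word :: "('a \<times> bool) list \<Rightarrow> bool" where
  "reduced_word u \<equiv> successively (\<lambda>l m. m \<noteq> flip l) u"

lemma free_reduce_simps [simp]:
  "free_reduce [] = []" "free_reduce (l # u) = reduce_cons l (free_reduce u)"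
  by (simp_all add: free_reduce_def)

lemma reduced_word_reduce_cons: "reduced_word u \<Longrightarrow> reduced_word (reduce_cons l u)"
  by (cases "(l, u)" rule: reduce_cons.cases) (auto simp: successively_Cons)

lemma reduced_word_free_reduce: "reduced_word (free_reduce u)"
  by (induction u) (auto intro: reduced_word_reduce_cons)

lemma set_free_reduce: "set (free_reduce u) \<subseteq> set u"
proof (induction u)
  case (Cons l u)
  have "set (reduce_cons l v) \<subseteq> insert l (set v)" for v
    by (cases "(l, v)" rule: reduce_cons.cases) auto
  with Cons show ?case by fastforce
qed simp

lemma free_reduce_reduced: "reduced_word u \<Longrightarrow> free_reduce u = u"
proof (induction u)
  case (Cons l u)
  then have "free_reduce u = u" by (auto simp: successively_Cons)
  with Cons.prems show ?case by (cases u) auto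
qed simp

text \<open>This fails for words that are not reduced: it needs that cancelling \<open>flip l\<close> against a first
  letter \<open>l\<close> leaves a word that does not start with \<open>flip l\<close>.\<close>

lemma reduce_cons_cancel: "reduced_word u \<Longrightarrow> reduce_cons l (reduce_cons (flip l) u) = u"
proof (cases u)
  case (Cons m v)
  assume "reduced_word u"
  with Cons show ?thesis by (cases v) auto
qed simp

lemma free_reduce_append: "free_reduce (u @ v) = foldr reduce_cons u (free_reduce v)"
  by (simp add: free_reduce_def)

lemma free_reduce_cong: "(u, v) \<in> free_cong S \<Longrightarrow> free_reduce u = free_reduce v"
proof (induction rule: word_cong.induct)
  case (base u v p q)
  then obtain x b where "u = [(x, b), flip (x, b)]" "v = []" by auto
  then show ?case
    by (simp only: free_reduce_append foldr.simps o_apply id_apply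
      reduce_cons_cancel[OF reduced_word_free_reduce])
qed auto

lemma (in group) word_val_free_reduce:
  "set u \<subseteq> carrier G \<times> UNIV \<Longrightarrow> word_val G (free_reduce u) = word_val G u"
proof (induction u)
  case (Cons l u)
  have "word_val G (reduce_cons l v) = literal G l \<otimes> word_val G v"
    if "set v \<subseteq> carrier G \<times> UNIV" for v
  proof (cases "(l, v)" rule: reduce_cons.cases)
    case (2 l' m v')
    have "fst l \<in> carrier G" using Cons.prems by auto
    moreover have "word_val G v' \<in> carrier G" using that 2 by simp
    ultimately show ?thesis using 2 by (auto simp: literal_flip m_assoc[symmetric])
  qed auto
  moreover have "set (free_reduce u) \<subseteq> carrier G \<times> UNIV"
    using set_free_reduce[of u] Cons.prems by auto
  ultimately show ?case using Cons by simp
qed simp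

lemma basis_word_val:
  assumes "group F" "basis F X"
  shows "w \<in> carrier F \<Longrightarrow> \<exists>u. set u \<subseteq> X \<times> UNIV \<and> word_val F u = w"
    and "set u \<subseteq> X \<times> UNIV \<Longrightarrow> set v \<subseteq> X \<times> UNIV \<Longrightarrow> word_val F u = word_val F v \<Longrightarrow>
      free_reduce u = free_reduce v"
proof -
  obtain \<phi> where \<phi>: "\<phi> \<in> iso (free_group X) F" "\<And>x. x \<in> X \<Longrightarrow> \<phi> (free_gen X x) = x"
    using assms(2) unfolding basis_def by blast
  interpret group_hom "free_group X" F \<phi>
    using assms(1) \<phi>(1) group_free_group by (simp add: group_hom_def group_hom_axioms_def iso_def)
  have val: "\<phi> (free_cong X `` {u}) = word_val F u" if "set u \<subseteq> X \<times> UNIV" for u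
  proof -
    have "map (\<lambda>l. apfst \<phi> (apfst (free_gen X) l)) u = u"
      using that \<phi>(2) by (intro map_idI) auto
    moreover have "set (map (apfst (free_gen X)) u) \<subseteq> carrier (free_group X) \<times> UNIV"
      using that free_gen_closed[of _ X] by auto
    ultimately show ?thesis
      by (simp only: free_class_word_val[OF that] hom_word_val list.map_comp o_def)
  qed
  have cls: "carrier (free_group X) = {free_cong X `` {u} |u. set u \<subseteq> X \<times> UNIV}"
    by (auto simp: free_group_def carrier_word_quotient lists_eq_set)
  show "\<exists>u. set u \<subseteq> X \<times> UNIV \<and> word_val F u = w" if "w \<in> carrier F" for w
  proof -
    have "w \<in> \<phi> ` carrier (free_group X)" using \<phi>(1) that by (simp add: iso_def bij_betw_def)
    then show ?thesis unfolding cls using val by auto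
  qed
  assume u: "set u \<subseteq> X \<times> UNIV" and v: "set v \<subseteq> X \<times> UNIV" and eq: "word_val F u = word_val F v"
  have "inj_on \<phi> (carrier (free_group X))" using \<phi>(1) by (simp add: iso_def bij_betw_def)
  then have "free_cong X `` {u} = free_cong X `` {v}"
    by (rule inj_onD) (use u v eq val cls in auto)
  then have "(u, v) \<in> free_cong X"
    using u v word_class_eq_iff[of u "X \<times> UNIV" v] by (auto simp: lists_eq_set)
  then show "free_reduce u = free_reduce v" by (rule free_reduce_cong)
qed

lemma basis_reduced_words:
  assumes "group F" "basis F X" "set u \<subseteq> X \<times> UNIV" "set v \<subseteq> X \<times> UNIV"
    "reduced_word u" "reduced_word v" "word_val F u = word_val F v"
  shows "u = v"
  using basis_word_val(2)[OF assms(1-4,7)] assms(5,6) by (simp add: free_reduce_reduced)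

text \<open>Words of length one are reduced, so distinct ones have distinct values. This excludes, for example,
  a basis element that equals its own inverse or the inverse of another one.\<close>

lemma basis_literal_inj:
  assumes "group F" "basis F X"
  shows "inj_on (literal F) (X \<times> UNIV)"
proof (rule inj_onI)
  interpret group F by fact
  fix l m assume lm: "l \<in> X \<times> (UNIV :: bool set)" "m \<in> X \<times> (UNIV :: bool set)"
    and eq: "literal F l = literal F m"
  have "X \<subseteq> carrier F" using assms(2) by (simp add: basis_def)
  then have "word_val F [l] = word_val F [m]" using lm eq by auto
  then have "[l] = [m]" using lm by (intro basis_reduced_words[OF assms]) auto
  then show "l = m" by simp
qed

lemma reduced_tuple_map_literal:
  assumes "group F" "basis F X" "set u \<subseteq> X \<times> UNIV"
  shows "reduced_tuple F X (map (literal F) u) \<longleftrightarrow> reduced_word u"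
proof -
  interpret group F by fact
  have X: "X \<subseteq> carrier F" using assms(2) by (simp add: basis_def)
  have "literal F m = inv\<^bsub>F\<^esub> (literal F l) \<longleftrightarrow> m = flip l" if "l \<in> set u" "m \<in> set u" for l m
  proof -
    have "l \<in> X \<times> UNIV" "m \<in> X \<times> UNIV" using that assms(3) by auto
    moreover from this have "flip l \<in> X \<times> UNIV" by (auto simp: flip_def)
    moreover have "inv\<^bsub>F\<^esub> (literal F l) = literal F (flip l)"
      using X \<open>l \<in> X \<times> UNIV\<close> by (intro literal_flip[symmetric]) auto
    ultimately show ?thesis using inj_on_eq_iff[OF basis_literal_inj[OF assms(1,2)]] by metis
  qed
  moreover have "literal F ` set u \<subseteq> X \<union> m_inv F ` X"
    using assms(3) by (auto simp: literal_def)
  ultimately show ?thesis by (auto simp: reduced_tuple_def successively_conv_nth)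
qed

text \<open>Existence and uniqueness of the reduced tuple. Both are needed to unfold the definite description
  in \<open>reduced_form\<close>.\<close>

lemma reduced_form_eq:
  assumes "group F" "basis F X" "w \<in> carrier F"
  obtains u where "set u \<subseteq> X \<times> UNIV" "word_val F u = w" "reduced_form F X w = map (literal F) u"
proof -
  interpret group F by fact
  have X: "X \<subseteq> carrier F" using assms(2) by (simp add: basis_def)
  obtain u' where u': "set u' \<subseteq> X \<times> UNIV" "word_val F u' = w"
    using basis_word_val(1)[OF assms] by blast
  define u where "u = free_reduce u'"
  have u: "set u \<subseteq> X \<times> UNIV" "word_val F u = w" "reduced_word u"
    using u' set_free_reduce[of u'] X word_val_free_reduce[of u'] reduced_word_free_reduce[of u']
    unfolding u_def by auto
  have "reduced_form F X w = map (literal F) u"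
    unfolding reduced_form_def
  proof (rule the_equality)
    show "reduced_tuple F X (map (literal F) u) \<and> list_prod F (map (literal F) u) = w"
      using reduced_tuple_map_literal[OF assms(1,2) u(1)] u by (simp add: word_val_def)
    fix ws assume ws: "reduced_tuple F X ws \<and> list_prod F ws = w"
    have "X \<union> m_inv F ` X \<subseteq> literal F ` (X \<times> UNIV)"
    proof
      fix y assume "y \<in> X \<union> m_inv F ` X"
      then obtain x where "x \<in> X" "y = literal F (x, True) \<or> y = literal F (x, False)"
        by (auto simp: literal_def)
      then show "y \<in> literal F ` (X \<times> UNIV)" by blast
    qed
    then have "ws \<in> lists (literal F ` (X \<times> UNIV))"
      using ws unfolding lists_eq_set reduced_tuple_def by blast
    then obtain v where "ws = map (literal F) v" "v \<in> lists (X \<times> UNIV)"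
      unfolding lists_image by (rule imageE)
    then have v: "ws = map (literal F) v" "set v \<subseteq> X \<times> UNIV" by auto
    then have "v = u"
      using ws u reduced_tuple_map_literal[OF assms(1,2) v(2)]
      by (intro basis_reduced_words[OF assms(1,2)]) (auto simp: word_val_def)
    with v show "ws = map (literal F) u" by simp
  qed
  with u show thesis by (intro that)
qed

text \<open>The combinatorial content of being prefundamental: every generator that occurs does so exactly
  twice, once with each sign.\<close>

definition quadratic :: "('a \<times> bool) list \<Rightarrow> bool" where
  "quadratic u \<longleftrightarrow> distinct u \<and> (\<forall>l\<in>set u. flip l \<in> set u)"

lemma prefundamental_quadratic_word:
  assumes "group F" "basis F X" "prefundamental F X w"
  obtains u where "set u \<subseteq> X \<times> UNIV" "word_val F u = w" "quadratic u"
proof -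
  interpret group F by fact
  have X: "X \<subseteq> carrier F" using assms(2) by (simp add: basis_def)
  have "w \<in> carrier F" using assms(3) by (simp add: prefundamental_def)
  then obtain u where u: "set u \<subseteq> X \<times> UNIV" "word_val F u = w"
    "reduced_form F X w = map (literal F) u"
    using reduced_form_eq[OF assms(1,2)] by blast
  have "flip l \<in> set u" if "l \<in> set u" for l
  proof -
    have l: "l \<in> X \<times> UNIV" "flip l \<in> X \<times> UNIV" using that u(1) by (auto simp: flip_def)
    then have "literal F l \<in> X \<union> m_inv F ` X" by (auto simp: literal_def)
    then have "inv\<^bsub>F\<^esub> (literal F l) \<in> literal F ` set u"
      using assms(3) that by (auto simp: prefundamental_def u(3))
    then have "literal F (flip l) \<in> literal F ` set u" using l X by (subst literal_flip) auto
    then show ?thesis using inj_on_image_mem_iff[OF basis_literal_inj[OF assms(1,2)] l(2) u(1)] by blast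
  qed
  moreover have "distinct u"
    using assms(3) by (simp add: prefundamental_def u(3) distinct_map)
  ultimately show thesis using u that by (simp add: quadratic_def)
qed

section \<open>Splitting off a commutator\<close>

text \<open>A Nielsen transformation, possibly composed with an inversion of \<open>x\<close>. The elements \<open>c\<close> and \<open>d\<close> do not
  involve \<open>x\<close>, hence they are fixed, and the equation for the image of \<open>x\<close> can be solved for \<open>x\<close>.\<close>

lemma elementary_automorphism:
  assumes "group F" "basis F X" "x \<in> X" "c \<in> generate F (X - {x})" "d \<in> generate F (X - {x})"
  obtains \<sigma> where "\<sigma> \<in> iso F F" "\<sigma> x = c \<otimes>\<^bsub>F\<^esub> literal F (x, b) \<otimes>\<^bsub>F\<^esub> d"
    "\<And>y. y \<in> X - {x} \<Longrightarrow> \<sigma> y = y"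
proof -
  interpret group F by fact
  have X: "X \<subseteq> carrier F" using assms(2) by (simp add: basis_def)
  then have x: "x \<in> carrier F" and X': "X - {x} \<subseteq> carrier F" using assms(3) by auto
  have c: "c \<in> carrier F" and d: "d \<in> carrier F"
    using assms(4,5) generate_in_carrier[OF X'] by auto
  define x' where "x' = c \<otimes>\<^bsub>F\<^esub> literal F (x, b) \<otimes>\<^bsub>F\<^esub> d"
  define x'' where "x'' = (if b then inv\<^bsub>F\<^esub> c \<otimes>\<^bsub>F\<^esub> x \<otimes>\<^bsub>F\<^esub> inv\<^bsub>F\<^esub> d else d \<otimes>\<^bsub>F\<^esub> inv\<^bsub>F\<^esub> x \<otimes>\<^bsub>F\<^esub> c)"
  have x': "x' \<in> carrier F" and x'': "x'' \<in> carrier F"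
    using x c d by (simp_all add: x'_def x''_def)
  then have ends: "(\<lambda>y. if y = x then x' else y) \<in> X \<rightarrow> carrier F"
    "(\<lambda>y. if y = x then x'' else y) \<in> X \<rightarrow> carrier F"
    using X by auto
  obtain \<sigma> where \<sigma>: "group_hom F F \<sigma>" "\<And>y. y \<in> X \<Longrightarrow> \<sigma> y = (if y = x then x' else y)"
    using basis_hom[OF assms(1,2,1), of "\<lambda>y. if y = x then x' else y"] ends by blast
  obtain \<tau> where \<tau>: "group_hom F F \<tau>" "\<And>y. y \<in> X \<Longrightarrow> \<tau> y = (if y = x then x'' else y)"
    using basis_hom[OF assms(1,2,1), of "\<lambda>y. if y = x then x'' else y"] ends by blast
  interpret \<sigma>: group_hom F F \<sigma> by fact
  interpret \<tau>: group_hom F F \<tau> by fact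
  note id = group_hom_id[OF assms(1)]
  have "\<sigma> y = y" if "y \<in> generate F (X - {x})" for y
    using hom_eq_on_generate[OF \<sigma>(1) id X' _ that] \<sigma>(2) by auto
  then have \<sigma>cd: "\<sigma> c = c" "\<sigma> d = d" using assms(4,5) by auto
  have "\<tau> y = y" if "y \<in> generate F (X - {x})" for y
    using hom_eq_on_generate[OF \<tau>(1) id X' _ that] \<tau>(2) by auto
  then have \<tau>cd: "\<tau> c = c" "\<tau> d = d" using assms(4,5) by auto
  have cancel: "y \<otimes>\<^bsub>F\<^esub> (inv\<^bsub>F\<^esub> y \<otimes>\<^bsub>F\<^esub> z) = z" "inv\<^bsub>F\<^esub> y \<otimes>\<^bsub>F\<^esub> (y \<otimes>\<^bsub>F\<^esub> z) = z"
    if "y \<in> carrier F" "z \<in> carrier F" for y z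
    using that by (simp_all add: m_assoc[symmetric])
  have "\<tau> x' = x"
    using x c d \<tau>(2) assms(3) \<tau>cd
    by (auto simp: x'_def x''_def literal_def m_assoc inv_mult_group cancel)
  moreover have "\<sigma> x'' = x"
    using x c d \<sigma>(2) assms(3) \<sigma>cd
    by (auto simp: x'_def x''_def literal_def m_assoc inv_mult_group cancel)
  ultimately have "\<sigma> \<in> iso F F"
    using \<sigma>(2) \<tau>(2) basis_generates[OF assms(1,2)]
    by (intro iso_by_generators[OF \<sigma>(1) \<tau>(1)]) auto
  then show thesis using \<sigma>(2) assms(3) by (intro that[of \<sigma>]) (auto simp: x'_def)
qed

text \<open>Two Nielsen transformations do not disturb each other if the multipliers involve neither of the two
  letters: the one for \<open>y\<close> followed by the one for \<open>x\<close> does both substitutions.\<close>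

lemma two_letter_automorphism:
  assumes "group F" "basis F X" "x \<in> X" "y \<in> X" "x \<noteq> y"
    and "c \<in> generate F (X - {x, y})" "d \<in> generate F (X - {x, y})"
    and "p \<in> generate F (X - {x, y})" "q \<in> generate F (X - {x, y})"
  obtains \<sigma> where "\<sigma> \<in> iso F F" "\<sigma> x = c \<otimes>\<^bsub>F\<^esub> literal F (x, b) \<otimes>\<^bsub>F\<^esub> d"
    "\<sigma> y = p \<otimes>\<^bsub>F\<^esub> literal F (y, b') \<otimes>\<^bsub>F\<^esub> q"
    "\<And>z. z \<in> X - {x, y} \<Longrightarrow> \<sigma> z = z"
proof -
  interpret group F by fact
  have X: "X \<subseteq> carrier F" using assms(2) by (simp add: basis_def)
  have gen: "generate F (X - {x, y}) \<subseteq> generate F (X - {x})"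
    "generate F (X - {x, y}) \<subseteq> generate F (X - {y})"
    by (rule mono_generate; blast)+
  obtain \<sigma> where \<sigma>: "\<sigma> \<in> iso F F" "\<sigma> x = c \<otimes>\<^bsub>F\<^esub> literal F (x, b) \<otimes>\<^bsub>F\<^esub> d"
    "\<And>z. z \<in> X - {x} \<Longrightarrow> \<sigma> z = z"
    using elementary_automorphism[OF assms(1-3), of c d] assms(6,7) gen by blast
  obtain \<tau> where \<tau>: "\<tau> \<in> iso F F" "\<tau> y = p \<otimes>\<^bsub>F\<^esub> literal F (y, b') \<otimes>\<^bsub>F\<^esub> q"
    "\<And>z. z \<in> X - {y} \<Longrightarrow> \<tau> z = z"
    using elementary_automorphism[OF assms(1,2,4), of p q] assms(8,9) gen by blast
  interpret \<sigma>: group_hom F F \<sigma> using \<sigma>(1) by unfold_locales (simp add: iso_def)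
  note id = group_hom_id[OF assms(1)]
  have "\<sigma> z = z" if "z \<in> generate F (X - {x})" for z
    by (rule hom_eq_on_generate[OF \<sigma>.group_hom_axioms id _ _ that]) (use \<sigma>(3) X in auto)
  then have pq: "\<sigma> p = p" "\<sigma> q = q" using assms(8,9) gen by auto
  have "p \<in> carrier F" "q \<in> carrier F"
    using assms(8,9) generate_in_carrier[of "X - {x, y}"] X by auto
  then have "\<sigma> (\<tau> y) = p \<otimes>\<^bsub>F\<^esub> literal F (y, b') \<otimes>\<^bsub>F\<^esub> q"
    using X assms(3-5) \<sigma>(3)[of y] \<tau>(2) pq by (auto simp: literal_def)
  moreover have "\<sigma> (\<tau> x) = c \<otimes>\<^bsub>F\<^esub> literal F (x, b) \<otimes>\<^bsub>F\<^esub> d"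
    using \<sigma>(2) \<tau>(3)[of x] assms(3,5) by simp
  moreover have "\<sigma> (\<tau> z) = z" if "z \<in> X - {x, y}" for z
    using \<sigma>(3) \<tau>(3) that by simp
  ultimately show thesis
    using iso_set_trans[OF \<tau>(1) \<sigma>(1)] by (intro that[of "\<sigma> \<circ> \<tau>"]) auto
qed

text \<open>This is the algebraic form of cutting and pasting a handle. The two entries of the commutator come
  from successive substitutions that shorten the gaps between the linked letters: with \<open>X = x a\<close> and
  \<open>Y = y b a\<close> the left-hand side is \<open>e X Y X\<^sup>-\<^sup>1 c b a Y\<^sup>-\<^sup>1 d\<close>, and with
  \<open>Z = (c b a)\<^sup>-\<^sup>1 X\<close> it is \<open>(e c b a) Z Y Z\<^sup>-\<^sup>1 Y\<^sup>-\<^sup>1 d\<close>. Conjugation by \<open>e c b a\<close> moves the prefix behind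
  the commutator. The entries are the inverses of the conjugates of \<open>Z\<close> and \<open>Y\<close>, as required by the
  convention \<open>[u, v] = u\<^sup>-\<^sup>1 v\<^sup>-\<^sup>1 u v\<close>. What matters is that each entry involves one of \<open>x\<close> and \<open>y\<close>, exactly once,
  and not the other.\<close>

lemma (in group) linked_pair_identity:
  assumes "a \<in> carrier G" "b \<in> carrier G" "c \<in> carrier G" "d \<in> carrier G" "e \<in> carrier G"
    and "x \<in> carrier G" "y \<in> carrier G"
  shows "e \<otimes> x \<otimes> a \<otimes> y \<otimes> b \<otimes> inv x \<otimes> c \<otimes> inv y \<otimes> d =
    comm_elt G (e \<otimes> c \<otimes> b \<otimes> inv x \<otimes> inv e) (e \<otimes> c \<otimes> inv y \<otimes> inv (e \<otimes> c \<otimes> b \<otimes> a))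
      \<otimes> (e \<otimes> c \<otimes> b \<otimes> a \<otimes> d)"
proof -
  have "y \<otimes> (inv y \<otimes> z) = z" "inv y \<otimes> (y \<otimes> z) = z"
    if "y \<in> carrier G" "z \<in> carrier G" for y z
    using that by (simp_all add: m_assoc[symmetric])
  with assms show ?thesis by (simp add: comm_elt_def m_assoc inv_mult_group)
qed

text \<open>By the preceding identity, a linked pair of letters can be turned into a commutator by an
  automorphism that substitutes only these two letters. Signs do no harm because the automorphism may also
  invert the letters.\<close>

lemma split_off_commutator:
  assumes "group F" "basis F X" "fst l \<in> X" "fst m \<in> X" "fst l \<noteq> fst m"
    and "set (e @ a @ b @ c @ d) \<subseteq> (X - {fst l, fst m}) \<times> UNIV"
  obtains \<sigma> where "\<sigma> \<in> iso F F" "\<And>z. z \<in> X - {fst l, fst m} \<Longrightarrow> \<sigma> z = z"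
    "word_val F (e @ l # a @ m # b @ flip l # c @ flip m # d) =
      comm_elt F (\<sigma> (fst l)) (\<sigma> (fst m)) \<otimes>\<^bsub>F\<^esub> word_val F (e @ c @ b @ a @ d)"
proof -
  interpret group F by fact
  have X: "X \<subseteq> carrier F" using assms(2) by (simp add: basis_def)
  let ?Y = "X - {fst l, fst m}" and ?v = "word_val F"
  have Y: "?Y \<subseteq> carrier F" using X by auto
  have sets: "set e \<subseteq> ?Y \<times> UNIV" "set a \<subseteq> ?Y \<times> UNIV" "set b \<subseteq> ?Y \<times> UNIV"
    "set c \<subseteq> ?Y \<times> UNIV" "set d \<subseteq> ?Y \<times> UNIV"
    using assms(6) by auto
  have words: "set e \<subseteq> carrier F \<times> UNIV" "set a \<subseteq> carrier F \<times> UNIV" "set b \<subseteq> carrier F \<times> UNIV"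
    "set c \<subseteq> carrier F \<times> UNIV" "set d \<subseteq> carrier F \<times> UNIV"
    by (rule order_trans[OF sets(1)] order_trans[OF sets(2)] order_trans[OF sets(3)]
      order_trans[OF sets(4)] order_trans[OF sets(5)]; use Y in blast)+
  note gen = word_val_in_generate[OF sets(1)] word_val_in_generate[OF sets(2)]
    word_val_in_generate[OF sets(3)] word_val_in_generate[OF sets(4)]
  have lm: "fst l \<in> carrier F" "fst m \<in> carrier F" using assms(3,4) X by auto
  obtain \<sigma> where \<sigma>: "\<sigma> \<in> iso F F"
    "\<sigma> (fst l) = (?v e \<otimes>\<^bsub>F\<^esub> ?v c \<otimes>\<^bsub>F\<^esub> ?v b) \<otimes>\<^bsub>F\<^esub> literal F (fst l, \<not> snd l) \<otimes>\<^bsub>F\<^esub> inv\<^bsub>F\<^esub> ?v e"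
    "\<sigma> (fst m) = (?v e \<otimes>\<^bsub>F\<^esub> ?v c) \<otimes>\<^bsub>F\<^esub> literal F (fst m, \<not> snd m) \<otimes>\<^bsub>F\<^esub>
      inv\<^bsub>F\<^esub> (?v e \<otimes>\<^bsub>F\<^esub> ?v c \<otimes>\<^bsub>F\<^esub> ?v b \<otimes>\<^bsub>F\<^esub> ?v a)"
    "\<And>z. z \<in> ?Y \<Longrightarrow> \<sigma> z = z"
    using two_letter_automorphism[OF assms(1-5), of "?v e \<otimes>\<^bsub>F\<^esub> ?v c \<otimes>\<^bsub>F\<^esub> ?v b" "inv\<^bsub>F\<^esub> ?v e"
        "?v e \<otimes>\<^bsub>F\<^esub> ?v c" "inv\<^bsub>F\<^esub> (?v e \<otimes>\<^bsub>F\<^esub> ?v c \<otimes>\<^bsub>F\<^esub> ?v b \<otimes>\<^bsub>F\<^esub> ?v a)" "\<not> snd l" "\<not> snd m"]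
      gen generate_m_inv_closed[OF Y] generate.eng by metis
  have "literal F (fst l, \<not> snd l) = inv\<^bsub>F\<^esub> literal F l" "literal F (fst m, \<not> snd m) = inv\<^bsub>F\<^esub> literal F m"
    using literal_flip[OF lm(1)] literal_flip[OF lm(2)] by (simp_all add: flip_def)
  then have "?v (e @ l # a @ m # b @ flip l # c @ flip m # d) =
      comm_elt F (\<sigma> (fst l)) (\<sigma> (fst m)) \<otimes>\<^bsub>F\<^esub> ?v (e @ c @ b @ a @ d)"
    using linked_pair_identity[of "?v a" "?v b" "?v c" "?v d" "?v e" "literal F l" "literal F m"] words lm
    unfolding \<sigma>(2,3) by (simp add: mem_Times_iff literal_flip m_assoc)
  with \<sigma>(1,4) show thesis by (intro that)
qed

text \<open>Among all pairs of mutually inverse letters choose one with the least distance. If nothing stands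
  between them, they cancel. Otherwise the partner of a letter between them cannot lie between them
  as well, so it lies outside and the two pairs are linked.\<close>

lemma quadratic_cases:
  assumes "quadratic u" "u \<noteq> []"
  obtains (cancel) e l d where "u = e @ l # flip l # d"
  | (linked) e l a m b c d where "u = e @ l # a @ m # b @ flip l # c @ flip m # d"
proof -
  have dist: "distinct u" and closed: "\<And>l. l \<in> set u \<Longrightarrow> flip l \<in> set u"
    using assms(1) by (auto simp: quadratic_def)
  define P where "P = (\<lambda>v. \<exists>e l d. u = e @ l # v @ flip l # d)"
  have "\<exists>v. P v"
  proof -
    obtain l u' where u: "u = l # u'" using assms(2) by (cases u) auto
    then have "flip l \<in> set u'" using closed[of l] by auto
    then obtain v d where "u' = v @ flip l # d" by (meson split_list)
    with u have "u = [] @ l # v @ flip l # d" by simp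
    then show ?thesis unfolding P_def by blast
  qed
  \<comment> \<open>Here \<open>v\<close> is the word between the two letters of a closest pair.\<close>
  then obtain v where "P v" and min: "\<And>v'. P v' \<Longrightarrow> length v \<le> length v'"
    using ex_has_least_nat[of P _ length] by metis
  then obtain e l d where u: "u = e @ l # v @ flip l # d" unfolding P_def by blast
  show thesis
  proof (cases v)
    case Nil
    then show thesis using u cancel by simp
  next
    case (Cons m v')
    then have "flip m \<in> set u" using closed[of m] u by simp
    moreover have "flip m \<noteq> l" "flip m \<noteq> flip l"
      using dist u Cons by (auto dest: arg_cong[where f = flip])
    moreover have "flip m \<notin> set v"
    proof
      assume "flip m \<in> set v"
      then obtain p q where "v' = p @ flip m # q"
        using Cons by (auto dest: split_list)
      then have "u = (e @ [l]) @ m # p @ flip m # (q @ flip l # d)" "length p < length v"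
        using u Cons by auto
      then show False using min[of p] unfolding P_def by fastforce
    qed
    ultimately have "flip m \<in> set e \<or> flip m \<in> set d" using u by auto
    then show thesis
    proof
      assume "flip m \<in> set d"
      then obtain c d' where "d = c @ flip m # d'" by (meson split_list)
      then have "u = e @ l # [] @ m # v' @ flip l # c @ flip m # d'" using u Cons by simp
      then show thesis by (rule linked)
    next
      assume "flip m \<in> set e"
      then obtain e' a where "e = e' @ flip m # a" by (meson split_list)
      \<comment> \<open>The partner of \<open>m\<close> comes first, so it takes the role of \<open>l\<close>, and \<open>l\<close> that of \<open>m\<close>.\<close>
      then have "u = e' @ flip m # a @ l # [] @ flip (flip m) # v' @ flip l # d" using u Cons by simp
      then show thesis by (rule linked)
    qed
  qed
qed

lemma quadratic_remove:
  assumes "quadratic u" "distinct v" "set v = set u - L" "flip ` L \<subseteq> L"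
  shows "quadratic v"
  unfolding quadratic_def
proof (intro conjI ballI)
  fix k assume "k \<in> set v"
  then have "flip k \<in> set u" "k \<notin> L" using assms(1,3) by (auto simp: quadratic_def)
  moreover have "flip k \<notin> L"
    using \<open>k \<notin> L\<close> assms(4) flip_simps(1)[of k] by (metis imageI subsetD)
  ultimately show "flip k \<in> set v" using assms(3) by auto
qed fact

definition comm_prod :: "('a, 'm) monoid_scheme \<Rightarrow> ('a \<times> 'a) list \<Rightarrow> 'a" where
  "comm_prod G ps = list_prod G (map (\<lambda>(a, b). comm_elt G a b) ps)"

definition pair_entries :: "('a \<times> 'a) list \<Rightarrow> 'a list" where
  "pair_entries ps = concat (map (\<lambda>(a, b). [a, b]) ps)"

lemma comm_prod_simps [simp]:
  "comm_prod G [] = \<one>\<^bsub>G\<^esub>" "comm_prod G ((a, b) # ps) = comm_elt G a b \<otimes>\<^bsub>G\<^esub> comm_prod G ps"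
  by (simp_all add: comm_prod_def)

lemma pair_entries_simps [simp]:
  "pair_entries [] = []" "pair_entries ((a, b) # ps) = a # b # pair_entries ps"
  by (simp_all add: pair_entries_def)

lemma (in group) comm_prod_closed:
  "set (pair_entries ps) \<subseteq> carrier G \<Longrightarrow> comm_prod G ps \<in> carrier G"
  by (induction ps) auto

text \<open>The set \<open>Y\<close> is there for the induction. After a commutator of \<open>x\<close> and \<open>y\<close> is split off,
  the induction hypothesis is used for the remaining word and for \<open>Y - {x, y}\<close>, and the automorphism
  that it provides must leave this commutator in place.\<close>

theorem quadratic_word_comm_prod:
  assumes "group F" "basis F X" "Y \<subseteq> X" "set u \<subseteq> Y \<times> UNIV" "quadratic u"
  shows "\<exists>\<sigma> ps. \<sigma> \<in> iso F F \<and> (\<forall>x\<in>X - Y. \<sigma> x = x) \<and> distinct (pair_entries ps) \<and>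
    set (pair_entries ps) \<subseteq> Y \<and> word_val F u = \<sigma> (comm_prod F ps)"
  using assms(3-5)
proof (induction "length u" arbitrary: u Y rule: less_induct)
  case less
  interpret group F by fact
  have X: "X \<subseteq> carrier F" using assms(2) by (simp add: basis_def)
  show ?case
  proof (cases "u = []")
    case True
    then show ?thesis
      by (intro exI[of _ "\<lambda>x. x"] exI[of _ "[]"])
        (simp add: iso_set_refl)
  next
    case False
    from less.prems(3) False show ?thesis
    proof (cases rule: quadratic_cases)
      case (cancel e l d)
      have "distinct (e @ d)" "set (e @ d) = set u - {l, flip l}"
        using less.prems(3) cancel by (auto simp: quadratic_def)
      then have "quadratic (e @ d)"
        by (intro quadratic_remove[OF less.prems(3), of _ "{l, flip l}"]) auto
      then have IH: "\<exists>\<sigma> ps. \<sigma> \<in> iso F F \<and> (\<forall>x\<in>X - Y. \<sigma> x = x) \<and> distinct (pair_entries ps) \<and>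
          set (pair_entries ps) \<subseteq> Y \<and> word_val F (e @ d) = \<sigma> (comm_prod F ps)"
        using less.prems(1,2) cancel by (intro less.hyps) auto
      have "set u \<subseteq> carrier F \<times> UNIV" using less.prems(1,2) X by fastforce
      then have carr: "fst l \<in> carrier F" "set e \<subseteq> carrier F \<times> UNIV" "set d \<subseteq> carrier F \<times> UNIV"
        using cancel by auto
      then have "literal F l \<otimes>\<^bsub>F\<^esub> (literal F (flip l) \<otimes>\<^bsub>F\<^esub> word_val F d) = word_val F d"
        by (simp add: literal_flip m_assoc[symmetric])
      then have "word_val F u = word_val F (e @ d)"
        using cancel carr by (simp add: mem_Times_iff)
      with IH show ?thesis by simp
    next
      case (linked e l a m b c d)
      let ?L = "{l, flip l, m, flip m}" and ?Y = "Y - {fst l, fst m}" and ?v = "e @ c @ b @ a @ d"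
      have dist: "distinct u" using less.prems(3) by (simp add: quadratic_def)
      have letters: "k = (fst l, b) \<Longrightarrow> k \<in> ?L" "k = (fst m, b) \<Longrightarrow> k \<in> ?L" for k b
        by (cases l; cases m; auto simp: flip_def)+
      have lm: "fst l \<noteq> fst m"
      proof
        assume "fst l = fst m"
        then have "l = m \<or> l = flip m" by (cases l; cases m) (auto simp: flip_def)
        then show False using dist linked by auto
      qed
      have "distinct ?v" "set ?v = set u - ?L"
        using dist unfolding linked by auto
      then have quad: "quadratic ?v"
        by (intro quadratic_remove[OF less.prems(3), of _ ?L]) auto
      have Y: "set ?v \<subseteq> ?Y \<times> UNIV"
      proof
        fix k assume "k \<in> set ?v"
        then have k: "k \<in> set u" "k \<notin> ?L" unfolding \<open>set ?v = set u - ?L\<close> by blast+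
        then have "fst k \<noteq> fst l" "fst k \<noteq> fst m"
          using letters[of k "snd k"] by (metis prod.collapse)+
        then show "k \<in> ?Y \<times> UNIV" using k(1) less.prems(2) by (auto simp: mem_Times_iff)
      qed
      moreover have "?Y \<subseteq> X" using less.prems(1) by auto
      moreover have "length ?v < length u" using linked by simp
      ultimately have "\<exists>\<tau> ps. \<tau> \<in> iso F F \<and> (\<forall>x\<in>X - ?Y. \<tau> x = x) \<and> distinct (pair_entries ps) \<and>
          set (pair_entries ps) \<subseteq> ?Y \<and> word_val F ?v = \<tau> (comm_prod F ps)"
        using quad by (intro less.hyps)
      then obtain \<tau> ps where \<tau>: "\<tau> \<in> iso F F" "\<And>x. x \<in> X - ?Y \<Longrightarrow> \<tau> x = x"
        "distinct (pair_entries ps)" "set (pair_entries ps) \<subseteq> ?Y" "word_val F ?v = \<tau> (comm_prod F ps)"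
        by blast
      have lm_in: "fst l \<in> Y" "fst m \<in> Y" using less.prems(2) linked by auto
      have "set (e @ a @ b @ c @ d) = set ?v" by auto
      also have "\<dots> \<subseteq> ?Y \<times> UNIV" by (rule Y)
      also have "\<dots> \<subseteq> (X - {fst l, fst m}) \<times> UNIV" using less.prems(1) by blast
      finally have others: "set (e @ a @ b @ c @ d) \<subseteq> (X - {fst l, fst m}) \<times> UNIV" .
      have lm_X: "fst l \<in> X" "fst m \<in> X" using lm_in less.prems(1) by auto
      obtain \<sigma> where \<sigma>: "\<sigma> \<in> iso F F" "\<And>z. z \<in> X - {fst l, fst m} \<Longrightarrow> \<sigma> z = z"
        "word_val F u = comm_elt F (\<sigma> (fst l)) (\<sigma> (fst m)) \<otimes>\<^bsub>F\<^esub> word_val F ?v"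
        by (rule split_off_commutator[OF assms(1,2) lm_X lm others, folded linked]) (rule that)
      interpret \<sigma>: group_hom F F \<sigma> using \<sigma>(1) by unfold_locales (simp add: iso_def)
      interpret \<tau>: group_hom F F \<tau> using \<tau>(1) by unfold_locales (simp add: iso_def)
      note id = group_hom_id[OF assms(1)]
      have carr: "fst l \<in> carrier F" "fst m \<in> carrier F" "comm_prod F ps \<in> carrier F"
        using lm_in less.prems(1) X \<tau>(4) by (auto intro!: comm_prod_closed)
      have "\<sigma> (word_val F ?v) = word_val F ?v"
        by (rule hom_eq_on_generate[OF \<sigma>.group_hom_axioms id _ _ word_val_in_generate[OF Y]])
          (use \<sigma>(2) X less.prems(1) in auto)
      moreover have "\<tau> (fst l) = fst l" "\<tau> (fst m) = fst m"
        using \<tau>(2) lm_in less.prems(1) by auto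
      \<comment> \<open>\<open>\<sigma>\<close> fixes the remaining word and \<open>\<tau>\<close> fixes the two letters, so that the composition produces both factors.\<close>
      ultimately have "word_val F u = (\<sigma> \<circ> \<tau>) (comm_prod F ((fst l, fst m) # ps))"
        using \<sigma>(3) \<tau>(5) carr
        by (simp add: \<sigma>.hom_comm_elt \<tau>.hom_comm_elt)
      moreover have "\<sigma> \<circ> \<tau> \<in> iso F F" by (rule iso_set_trans[OF \<tau>(1) \<sigma>(1)])
      moreover have "(\<sigma> \<circ> \<tau>) x = x" if "x \<in> X - Y" for x
        using that \<sigma>(2) \<tau>(2) lm_in by auto
      moreover have "distinct (pair_entries ((fst l, fst m) # ps))"
        "set (pair_entries ((fst l, fst m) # ps)) \<subseteq> Y"
        using \<tau>(3,4) lm lm_in by auto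
      ultimately show ?thesis by blast
    qed
  qed
qed

section \<open>One-relator quotients and free products\<close>

abbreviation rel_class :: "('a, 'm) monoid_scheme \<Rightarrow> 'a \<Rightarrow> 'a \<Rightarrow> 'a set" where
  "rel_class G w x \<equiv> normal_closure G {w} #>\<^bsub>G\<^esub> x"

lemma rel_class_hom:
  assumes "group G" "w \<in> carrier G"
  shows "group_hom G (G Mod normal_closure G {w}) (rel_class G w)"
    and "rel_class G w w = \<one>\<^bsub>G Mod normal_closure G {w}\<^esub>"
proof -
  interpret group G by fact
  have N: "normal_closure G {w} \<lhd> G" using assms(2) by (intro normal_closure_normal) auto
  show "group_hom G (G Mod normal_closure G {w}) (rel_class G w)"
    using normal.r_coset_hom_Mod[OF N] normal.factorgroup_is_group[OF N] assms(1)
    by (simp add: group_hom_def group_hom_axioms_def)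
  have "w \<in> normal_closure G {w}" by (auto simp: normal_closure_def)
  then have "rel_class G w w = normal_closure G {w}"
    using coset_join2[OF assms(2)] normal_imp_subgroup[OF N] by blast
  then show "rel_class G w w = \<one>\<^bsub>G Mod normal_closure G {w}\<^esub>" by simp
qed

text \<open>The universal property of a one-relator quotient: the kernel is a normal subgroup containing the
  relator, hence contains its normal closure.\<close>

lemma quotient_hom:
  assumes "group_hom G K h" "w \<in> carrier G" "h w = \<one>\<^bsub>K\<^esub>"
  obtains k where "group_hom (G Mod normal_closure G {w}) K k"
    "\<And>x. x \<in> carrier G \<Longrightarrow> k (rel_class G w x) = h x"
proof -
  interpret group_hom G K h by fact
  have N: "normal_closure G {w} \<lhd> G" using assms(2) by (intro G.normal_closure_normal) auto
  have "w \<in> kernel G K h" using assms(2,3) by (simp add: kernel_def)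
  then have "normal_closure G {w} \<subseteq> kernel G K h"
    using normal_kernel by (auto simp: normal_closure_def)
  then obtain k where k: "k \<in> hom (G Mod normal_closure G {w}) K"
    "\<And>x. x \<in> carrier G \<Longrightarrow> k (rel_class G w x) = h x"
    using FactGroup_universal_kernel[OF N] by blast
  then show thesis
    using normal.factorgroup_is_group[OF N] H.group_axioms
    by (intro that[of k]) (simp_all add: group_hom_def group_hom_axioms_def)
qed

lemma generate_quotient:
  assumes "group G" "w \<in> carrier G" "generate G Y = carrier G"
  shows "generate (G Mod normal_closure G {w}) (rel_class G w ` Y) =
    carrier (G Mod normal_closure G {w})"
proof -
  interpret p: group_hom G "G Mod normal_closure G {w}" "rel_class G w"
    by (rule rel_class_hom[OF assms(1,2)])
  have "Y \<subseteq> carrier G" using generate.incl[of _ Y G] assms(3) by auto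
  from p.generate_img[OF this] show ?thesis
    by (simp only: assms(3) carrier_FactGroup)
qed

lemma quotient_iso:
  assumes "group G" "group H" "\<sigma> \<in> iso G H" "w \<in> carrier G"
  shows "G Mod normal_closure G {w} \<cong> H Mod normal_closure H {\<sigma> w}"
proof -
  interpret G: group G by fact
  obtain \<tau> where "group_isomorphisms G H \<sigma> \<tau>"
    using assms(3) unfolding G.iso_iff_group_isomorphisms by blast
  then have hom: "group_hom G H \<sigma>" "group_hom H G \<tau>"
    and inv: "\<And>x. x \<in> carrier G \<Longrightarrow> \<tau> (\<sigma> x) = x" "\<And>y. y \<in> carrier H \<Longrightarrow> \<sigma> (\<tau> y) = y"
    using assms(1,2) by (auto simp: group_isomorphisms_def group_hom_def group_hom_axioms_def)
  interpret \<sigma>: group_hom G H \<sigma> by fact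
  interpret \<tau>: group_hom H G \<tau> by fact
  have \<sigma>w: "\<sigma> w \<in> carrier H" using assms(4) by simp
  let ?Q = "G Mod normal_closure G {w}" and ?R = "H Mod normal_closure H {\<sigma> w}"
  interpret p: group_hom G ?Q "rel_class G w" by (rule rel_class_hom[OF assms(1,4)])
  interpret q: group_hom H ?R "rel_class H (\<sigma> w)" by (rule rel_class_hom[OF assms(2) \<sigma>w])
  from quotient_hom[OF group_hom_compose[OF hom(1) q.group_hom_axioms] assms(4) rel_class_hom(2)[OF assms(2) \<sigma>w]]
  obtain f where f: "group_hom ?Q ?R f"
    "\<And>x. x \<in> carrier G \<Longrightarrow> f (rel_class G w x) = rel_class H (\<sigma> w) (\<sigma> x)" by blast
  have "rel_class G w (\<tau> (\<sigma> w)) = \<one>\<^bsub>?Q\<^esub>"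
    unfolding inv(1)[OF assms(4)] by (rule rel_class_hom(2)[OF assms(1,4)])
  then obtain g where g: "group_hom ?R ?Q g"
    "\<And>x. x \<in> carrier H \<Longrightarrow> g (rel_class H (\<sigma> w) x) = rel_class G w (\<tau> x)"
    using quotient_hom[OF group_hom_compose[OF hom(2) p.group_hom_axioms] \<sigma>w] by blast
  have gen: "generate G (carrier G) = carrier G" "generate H (carrier H) = carrier H"
    using G.generate_incl[of "carrier G"] \<sigma>.H.generate_incl[of "carrier H"]
    by (auto intro: generate.incl)
  have "f \<in> iso ?Q ?R"
    using generate_quotient[OF assms(1,4) gen(1)] generate_quotient[OF assms(2) \<sigma>w gen(2)]
    by (rule iso_by_generators[OF f(1) g(1)]) (use f(2) g(2) inv in auto)
  then show ?thesis by (rule is_isoI)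
qed

abbreviation free_product_class where
  "free_product_class G H \<equiv> \<lambda>u. word_cong (carrier G <+> carrier H) (free_product_rel G H) `` {u}"

definition prod_inl :: "('a, 'm) monoid_scheme \<Rightarrow> ('b, 'n) monoid_scheme \<Rightarrow> 'a \<Rightarrow> ('a + 'b) list set" where
  "prod_inl G H x = free_product_class G H [Inl x]"

definition prod_inr :: "('a, 'm) monoid_scheme \<Rightarrow> ('b, 'n) monoid_scheme \<Rightarrow> 'b \<Rightarrow> ('a + 'b) list set" where
  "prod_inr G H y = free_product_class G H [Inr y]"

lemma free_product_class_rel:
  assumes "(u, v) \<in> free_product_rel G H" "set u \<subseteq> carrier G <+> carrier H" "set v \<subseteq> carrier G <+> carrier H"
  shows "free_product_class G H u = free_product_class G H v"
  using word_cong.base[OF assms(1), of "carrier G <+> carrier H" "[]" "[]"] assms(2,3)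
  by (subst word_class_eq_iff) (auto simp: lists_eq_set)

lemma free_product_embeddings:
  assumes "group G" "group H"
  shows "group_hom G (G \<star> H) (prod_inl G H)" "group_hom H (G \<star> H) (prod_inr G H)"
proof -
  interpret G: group G by fact
  interpret H: group H by fact
  interpret P: group "G \<star> H" by (rule group_free_product) fact+
  have l: "prod_inl G H x \<otimes>\<^bsub>G \<star> H\<^esub> prod_inl G H y = prod_inl G H (x \<otimes>\<^bsub>G\<^esub> y)"
    if "x \<in> carrier G" "y \<in> carrier G" for x y
  proof -
    have "prod_inl G H x \<otimes>\<^bsub>G \<star> H\<^esub> prod_inl G H y = free_product_class G H [Inl x, Inl y]"
      using that by (simp add: prod_inl_def free_product_def mult_word_quotient InlI InrI)
    also have "\<dots> = prod_inl G H (x \<otimes>\<^bsub>G\<^esub> y)"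
      unfolding prod_inl_def using that
      by (intro free_product_class_rel) (auto simp: free_product_rel_def)
    finally show ?thesis .
  qed
  have r: "prod_inr G H x \<otimes>\<^bsub>G \<star> H\<^esub> prod_inr G H y = prod_inr G H (x \<otimes>\<^bsub>H\<^esub> y)"
    if "x \<in> carrier H" "y \<in> carrier H" for x y
  proof -
    have "prod_inr G H x \<otimes>\<^bsub>G \<star> H\<^esub> prod_inr G H y = free_product_class G H [Inr x, Inr y]"
      using that by (simp add: prod_inr_def free_product_def mult_word_quotient InlI InrI)
    also have "\<dots> = prod_inr G H (x \<otimes>\<^bsub>H\<^esub> y)"
      unfolding prod_inr_def using that
      by (intro free_product_class_rel) (auto simp: free_product_rel_def)
    finally show ?thesis .
  qed
  have "prod_inl G H x \<in> carrier (G \<star> H)" if "x \<in> carrier G" for x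
    unfolding prod_inl_def free_product_def carrier_word_quotient using that by (intro imageI) auto
  then show "group_hom G (G \<star> H) (prod_inl G H)" by unfold_locales (auto intro!: homI simp: l)
  have "prod_inr G H x \<in> carrier (G \<star> H)" if "x \<in> carrier H" for x
    unfolding prod_inr_def free_product_def carrier_word_quotient using that by (intro imageI) auto
  then show "group_hom H (G \<star> H) (prod_inr G H)" by unfold_locales (auto intro!: homI simp: r)
qed

lemma free_product_hom:
  assumes "group_hom G K \<alpha>" "group_hom H K \<beta>"
  obtains h where "group_hom (G \<star> H) K h"
    "\<And>x. x \<in> carrier G \<Longrightarrow> h (prod_inl G H x) = \<alpha> x"
    "\<And>y. y \<in> carrier H \<Longrightarrow> h (prod_inr G H y) = \<beta> y"
proof -
  interpret \<alpha>: group_hom G K \<alpha> by fact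
  interpret \<beta>: group_hom H K \<beta> by fact
  have PiE: "case_sum \<alpha> \<beta> \<in> carrier G <+> carrier H \<rightarrow> carrier K" by auto
  obtain h where h: "h \<in> hom (G \<star> H) K"
    "\<And>u. u \<in> lists (carrier G <+> carrier H) \<Longrightarrow>
      h (free_product_class G H u) = list_prod K (map (case_sum \<alpha> \<beta>) u)"
    unfolding free_product_def
    by (rule word_quotient_hom[OF \<alpha>.H.is_monoid PiE, of "free_product_rel G H"])
      (auto simp: free_product_rel_def)
  show thesis
  proof (rule that)
    show "group_hom (G \<star> H) K h"
      using h(1) group_free_product[OF \<alpha>.G.group_axioms \<beta>.G.group_axioms] \<alpha>.H.group_axioms
      by (simp add: group_hom_def group_hom_axioms_def)
    show "h (prod_inl G H x) = \<alpha> x" if "x \<in> carrier G" for x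
      unfolding prod_inl_def using that by (subst h(2)) auto
    show "h (prod_inr G H y) = \<beta> y" if "y \<in> carrier H" for y
      unfolding prod_inr_def using that by (subst h(2)) auto
  qed
qed

lemma generate_free_product:
  assumes "group G" "group H" "generate G Y = carrier G" "generate H Z = carrier H"
  shows "generate (G \<star> H) (prod_inl G H ` Y \<union> prod_inr G H ` Z) = carrier (G \<star> H)"
proof -
  interpret l: group_hom G "G \<star> H" "prod_inl G H" by (rule free_product_embeddings[OF assms(1,2)])
  interpret r: group_hom H "G \<star> H" "prod_inr G H" by (rule free_product_embeddings[OF assms(1,2)])
  have Y: "Y \<subseteq> carrier G" and Z: "Z \<subseteq> carrier H"
    using generate.incl[of _ Y G] generate.incl[of _ Z H] assms(3,4) by auto
  let ?gen = "generate (G \<star> H) (prod_inl G H ` Y \<union> prod_inr G H ` Z)"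
  have "generate (G \<star> H) (prod_inl G H ` Y) \<subseteq> ?gen" "generate (G \<star> H) (prod_inr G H ` Z) \<subseteq> ?gen"
    by (rule l.H.mono_generate; blast)+
  then have "prod_inl G H ` carrier G \<subseteq> ?gen" "prod_inr G H ` carrier H \<subseteq> ?gen"
    by (simp_all only: l.generate_img[OF Y] r.generate_img[OF Z] assms(3,4))
  then have letters: "free_product_class G H [s] \<in> ?gen" if "s \<in> carrier G <+> carrier H" for s
    using that by (auto simp: prod_inl_def prod_inr_def)
  have carr: "prod_inl G H ` Y \<union> prod_inr G H ` Z \<subseteq> carrier (G \<star> H)"
    using Y Z l.hom_closed r.hom_closed by blast
  show ?thesis
    using generate_word_quotient[OF _ _ carr[unfolded free_product_def]]
      letters l.H.group_axioms unfolding free_product_def by blast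
qed

section \<open>The quotient by a product of commutators\<close>

text \<open>A list of pairs is made comparable with the standard letters by writing it as an image of the list
  of pairs of standard letters. Distinctness of its entries then says that the map of letters is
  injective.\<close>

definition surface_pairs :: "nat \<Rightarrow> (surface_letter \<times> surface_letter) list" where
  "surface_pairs g = map (\<lambda>i. (A i, B i)) [1..<Suc g]"

lemma set_pair_entries_surface_pairs: "set (pair_entries (surface_pairs g)) = surface_letters g"
  by (auto simp: pair_entries_def surface_pairs_def surface_letters_def)

lemma surface_relator_comm_prod:
  "surface_relator g = comm_prod (free_group (surface_letters g))
     (map (map_prod (free_gen (surface_letters g)) (free_gen (surface_letters g))) (surface_pairs g))"
  by (simp add: surface_relator_def surface_pairs_def comm_prod_def Let_def o_def)

lemma pair_entries_map: "pair_entries (map (map_prod f f) ps) = map f (pair_entries ps)"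
  by (induction ps) auto

lemma (in group_hom) hom_comm_prod:
  assumes "\<And>x. x \<in> set (pair_entries qs) \<Longrightarrow> s x \<in> carrier G"
    and "\<And>x. x \<in> set (pair_entries qs) \<Longrightarrow> h (s x) = k x"
  shows "h (comm_prod G (map (map_prod s s) qs)) = comm_prod H (map (map_prod k k) qs)"
  using assms
proof (induction qs)
  case (Cons q qs)
  obtain x y where "q = (x, y)" by (cases q)
  moreover from this have "comm_prod G (map (map_prod s s) qs) \<in> carrier G"
    using Cons.prems(1) by (intro G.comm_prod_closed) (auto simp: pair_entries_map)
  ultimately show ?case using Cons by (simp add: hom_comm_elt)
qed simp

lemma length_pair_entries: "length (pair_entries ps) = 2 * length ps"
  by (induction ps) auto

lemma pairs_as_surface_pairs:
  obtains s where "ps = map (map_prod s s) (surface_pairs (length ps))"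
proof
  let ?s = "\<lambda>l. case l of A i \<Rightarrow> fst (ps ! (i - 1)) | B i \<Rightarrow> snd (ps ! (i - 1))"
  show "ps = map (map_prod ?s ?s) (surface_pairs (length ps))"
    by (rule nth_equalityI) (simp_all add: surface_pairs_def del: upt_Suc)
qed

text \<open>The quotient has generators indexed by the surface letters, which satisfy the surface relation, and
  further generators which satisfy no relation. This is also the presentation of the free product.\<close>

lemma comm_prod_quotient:
  assumes "group F" "basis F X" "finite X" "distinct (pair_entries ps)" "set (pair_entries ps) \<subseteq> X"
  shows "F Mod normal_closure F {comm_prod F ps} \<cong>
    surface_group (length ps) \<star> free_group {1..card X - 2 * length ps}"
proof -
  interpret F: group F by fact
  have X: "X \<subseteq> carrier F" using assms(2) by (simp add: basis_def)
  define g where "g = length ps"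
  define r where "r = card X - 2 * g"
  let ?S = "surface_letters g" and ?w = "comm_prod F ps"
  let ?FS = "free_group ?S" and ?Fr = "free_group {1..r}"
  let ?G = "surface_group g" and ?M = "F Mod normal_closure F {?w}"
  let ?Q = "?G \<star> ?Fr"
  have w: "?w \<in> carrier F" using assms(5) X by (intro F.comm_prod_closed) auto
  obtain s where ps: "ps = map (map_prod s s) (surface_pairs g)"
    using pairs_as_surface_pairs unfolding g_def by blast
  then have entries: "pair_entries ps = map s (pair_entries (surface_pairs g))"
    by (metis pair_entries_map)
  have inj_s: "inj_on s ?S" and im_s: "s ` ?S = set (pair_entries ps)"
    using assms(4) unfolding entries distinct_map set_map set_pair_entries_surface_pairs by auto
  have "card (X - s ` ?S) = r"
    unfolding im_s unfolding r_def g_def using assms(3-5)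
    by (simp add: card_Diff_subset distinct_card length_pair_entries)
  moreover have "finite (X - s ` ?S)" using assms(3) by simp
  ultimately obtain t where t: "bij_betw t {1..r} (X - s ` ?S)"
    using ex_bij_betw_nat_finite_1 by blast
  interpret FS: group ?FS by (rule group_free_group)
  have gensS: "free_gen ?S ` ?S \<subseteq> carrier ?FS" using free_gen_closed[of _ ?S] by blast
  let ?R = "surface_relator g"
  have entriesS: "set (pair_entries (map (map_prod (free_gen ?S) (free_gen ?S)) (surface_pairs g)))
      \<subseteq> carrier ?FS"
    using gensS by (simp add: pair_entries_map set_pair_entries_surface_pairs)
  have R: "?R \<in> carrier ?FS"
    unfolding surface_relator_comm_prod using entriesS by (rule FS.comm_prod_closed)
  have G_eq: "?G = ?FS Mod normal_closure ?FS {?R}" by (simp add: surface_group_def)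
  interpret \<kappa>: group_hom ?FS ?G "rel_class ?FS ?R"
    unfolding G_eq by (rule rel_class_hom[OF group_free_group R])
  interpret l: group_hom ?G ?Q "prod_inl ?G ?Fr"
    by (rule free_product_embeddings[OF \<kappa>.H.group_axioms group_free_group])
  interpret r: group_hom ?Fr ?Q "prod_inr ?G ?Fr"
    by (rule free_product_embeddings[OF \<kappa>.H.group_axioms group_free_group])
  interpret \<pi>: group_hom F ?M "rel_class F ?w" by (rule rel_class_hom[OF assms(1) w])
  define a where "a = (\<lambda>x. prod_inl ?G ?Fr (rel_class ?FS ?R (free_gen ?S x)))"
  define b where "b = (\<lambda>j. prod_inr ?G ?Fr (free_gen {1..r} j))"
  interpret a: group_hom ?FS ?Q "\<lambda>x. prod_inl ?G ?Fr (rel_class ?FS ?R x)"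
    by (rule group_hom_compose[OF \<kappa>.group_hom_axioms l.group_hom_axioms])
  have a_closed: "a x \<in> carrier ?Q" if "x \<in> ?S" for x
    unfolding a_def using gensS that by (intro a.hom_closed) blast
  have b_closed: "b j \<in> carrier ?Q" if "j \<in> {1..r}" for j
    unfolding b_def using free_gen_closed[OF that] by (rule r.hom_closed)

  \<comment> \<open>The homomorphism from the quotient to the free product, prescribed on the basis.\<close>
  define f0 where "f0 = (\<lambda>x. if x \<in> s ` ?S then a (inv_into ?S s x) else b (inv_into {1..r} t x))"
  have f0_s: "f0 (s x) = a x" if "x \<in> ?S" for x
    using that inj_s by (simp add: f0_def)
  have f0_t: "f0 (t j) = b j" if "j \<in> {1..r}" for j
  proof -
    have "t j \<in> X - s ` ?S" using bij_betwE[OF t] that by blast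
    then show ?thesis using bij_betw_inv_into_left[OF t that] by (simp add: f0_def)
  qed
  have X_cases: "(\<exists>y\<in>?S. x = s y) \<or> (\<exists>j\<in>{1..r}. x = t j)" if "x \<in> X" for x
    using that bij_betw_imp_surj_on[OF t] by blast
  have "f0 \<in> X \<rightarrow> carrier ?Q"
    using X_cases f0_s f0_t a_closed b_closed by (metis Pi_I)
  then obtain f1 where f1: "group_hom F ?Q f1" "\<And>x. x \<in> X \<Longrightarrow> f1 x = f0 x"
    using basis_hom[OF assms(1,2) l.H.group_axioms] by blast
  have s_X: "s x \<in> X" if "x \<in> ?S" for x using that im_s assms(5) by blast
  have t_X: "t j \<in> X" if "j \<in> {1..r}" for j using bij_betwE[OF t] that by blast
  have f1_s: "f1 (s x) = a x" if "x \<in> ?S" for x using f1(2)[OF s_X] f0_s that by simp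
  have f1_t: "f1 (t j) = b j" if "j \<in> {1..r}" for j using f1(2)[OF t_X] f0_t that by simp
  have s_F: "s x \<in> carrier F" if "x \<in> ?S" for x using s_X[OF that] X by blast
  have gen_FS: "free_gen ?S x \<in> carrier ?FS" if "x \<in> ?S" for x using that by (rule free_gen_closed)
  have "f1 ?w = comm_prod ?Q (map (map_prod a a) (surface_pairs g))"
    unfolding ps
    by (rule group_hom.hom_comm_prod[OF f1(1)])
      (use f1_s s_F in \<open>simp_all add: set_pair_entries_surface_pairs\<close>)
  also have "\<dots> = prod_inl ?G ?Fr (rel_class ?FS ?R ?R)"
    unfolding surface_relator_comm_prod[THEN arg_cong[where f = "\<lambda>v. prod_inl ?G ?Fr (rel_class ?FS ?R v)"]]
    by (rule a.hom_comm_prod[symmetric])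
      (use gen_FS in \<open>simp_all add: set_pair_entries_surface_pairs a_def\<close>)
  also have "\<dots> = \<one>\<^bsub>?Q\<^esub>"
    by (simp only: rel_class_hom(2)[OF group_free_group R, folded G_eq] l.hom_one)
  finally have "f1 ?w = \<one>\<^bsub>?Q\<^esub>" .
  then obtain f where f: "group_hom ?M ?Q f" "\<And>x. x \<in> carrier F \<Longrightarrow> f (rel_class F ?w x) = f1 x"
    using quotient_hom[OF f1(1) w] by blast

  \<comment> \<open>The homomorphism in the opposite direction, first on each of the two factors.\<close>
  have "(\<lambda>x. rel_class F ?w (s x)) \<in> ?S \<rightarrow> carrier ?M" using \<pi>.hom_closed[OF s_F] by blast
  then obtain k1 where k1: "group_hom ?FS ?M k1" "\<And>x. x \<in> ?S \<Longrightarrow> k1 (free_gen ?S x) = rel_class F ?w (s x)"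
    by (rule free_group_hom[OF \<pi>.H.group_axioms]) (rule that)
  have "k1 ?R = comm_prod ?M (map (map_prod (rel_class F ?w \<circ> s) (rel_class F ?w \<circ> s)) (surface_pairs g))"
    unfolding surface_relator_comm_prod
    by (rule group_hom.hom_comm_prod[OF k1(1)])
      (use k1(2) gen_FS in \<open>simp_all add: set_pair_entries_surface_pairs\<close>)
  also have "\<dots> = rel_class F ?w (comm_prod F (map (map_prod s s) (surface_pairs g)))"
    by (rule \<pi>.hom_comm_prod[symmetric])
      (use s_F in \<open>simp_all add: set_pair_entries_surface_pairs\<close>)
  also have "\<dots> = rel_class F ?w ?w" unfolding ps ..
  also have "\<dots> = \<one>\<^bsub>?M\<^esub>" by (rule rel_class_hom(2)[OF assms(1) w])
  finally obtain k where k: "group_hom ?G ?M k"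
    "\<And>x. x \<in> carrier ?FS \<Longrightarrow> k (rel_class ?FS ?R x) = k1 x"
    using quotient_hom[OF k1(1) R] unfolding G_eq by blast
  have t_F: "t j \<in> carrier F" if "j \<in> {1..r}" for j using t_X[OF that] X by blast
  have "(\<lambda>j. rel_class F ?w (t j)) \<in> {1..r} \<rightarrow> carrier ?M" using \<pi>.hom_closed[OF t_F] by blast
  then obtain m where m: "group_hom ?Fr ?M m" "\<And>j. j \<in> {1..r} \<Longrightarrow> m (free_gen {1..r} j) = rel_class F ?w (t j)"
    by (rule free_group_hom[OF \<pi>.H.group_axioms]) (rule that)
  obtain h where h: "group_hom ?Q ?M h"
    "\<And>x. x \<in> carrier ?G \<Longrightarrow> h (prod_inl ?G ?Fr x) = k x"
    "\<And>x. x \<in> carrier ?Fr \<Longrightarrow> h (prod_inr ?G ?Fr x) = m x"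
    using free_product_hom[OF k(1) m(1)] by blast
  have h_a: "h (a x) = rel_class F ?w (s x)" if "x \<in> ?S" for x
  proof -
    have "h (a x) = k (rel_class ?FS ?R (free_gen ?S x))"
      unfolding a_def by (rule h(2)[OF \<kappa>.hom_closed[OF gen_FS[OF that]]])
    then show ?thesis by (simp only: k(2)[OF gen_FS[OF that]] k1(2)[OF that])
  qed
  have h_b: "h (b j) = rel_class F ?w (t j)" if "j \<in> {1..r}" for j
    unfolding b_def using h(3)[OF free_gen_closed[OF that]] m(2)[OF that] by simp

  \<comment> \<open>The two homomorphisms exchange the generators, so they are inverse to each other.\<close>
  have gen_M: "generate ?M (rel_class F ?w ` X) = carrier ?M"
    by (rule generate_quotient[OF assms(1) w basis_generates[OF assms(1,2)]])
  have "generate ?G (rel_class ?FS ?R ` free_gen ?S ` ?S) = carrier ?G"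
    unfolding G_eq by (rule generate_quotient[OF group_free_group R generate_free_group])
  then have gen_Q: "generate ?Q (prod_inl ?G ?Fr ` rel_class ?FS ?R ` free_gen ?S ` ?S \<union>
      prod_inr ?G ?Fr ` free_gen {1..r} ` {1..r}) = carrier ?Q"
    by (intro generate_free_product \<kappa>.H.group_axioms group_free_group generate_free_group)
  have "f \<in> iso ?M ?Q"
  proof (rule iso_by_generators[OF f(1) h(1) gen_M gen_Q])
    fix y assume "y \<in> rel_class F ?w ` X"
    then obtain x where x: "x \<in> X" "y = rel_class F ?w x" by blast
    then have "f y = f1 x" using f(2) X by blast
    then show "h (f y) = y" using X_cases[OF x(1)] x(2) f1_s f1_t h_a h_b by metis
  next
    fix y assume "y \<in> prod_inl ?G ?Fr ` rel_class ?FS ?R ` free_gen ?S ` ?S \<union>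
      prod_inr ?G ?Fr ` free_gen {1..r} ` {1..r}"
    then consider x where "x \<in> ?S" "y = a x" | j where "j \<in> {1..r}" "y = b j"
      unfolding a_def b_def by blast
    then show "f (h y) = y"
    proof cases
      case 1
      then show ?thesis by (simp only: h_a f(2)[OF s_F] f1_s)
    next
      case 2
      then show ?thesis by (simp only: h_b f(2)[OF t_F] f1_t)
    qed
  qed
  then show ?thesis unfolding g_def r_def by (rule is_isoI)
qed

theorem proposition2p2p14:
  fixes F :: "('a, 'm) monoid_scheme" and X :: "'a set" and w :: 'a and n :: nat
  assumes "group F"
    and "\<exists>S. finite S \<and> basis F S"
    and "basis F X" and "finite X" and "card X = n"
    and "prefundamental F X w"
  shows "\<exists>g r :: nat. 2 * g \<le> n \<and> r = n - 2 * g \<and>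
    F Mod normal_closure F {w} \<cong> surface_group g \<star> free_group {1..r}"
proof -
  interpret group F by fact
  have X: "X \<subseteq> carrier F" using assms(3) by (simp add: basis_def)
  obtain u where u: "set u \<subseteq> X \<times> UNIV" "word_val F u = w" "quadratic u"
    using prefundamental_quadratic_word[OF assms(1,3,6)] by blast
  obtain \<sigma> ps where \<sigma>: "\<sigma> \<in> iso F F" "w = \<sigma> (comm_prod F ps)"
    and ps: "distinct (pair_entries ps)" "set (pair_entries ps) \<subseteq> X"
    using quadratic_word_comm_prod[OF assms(1,3) order_refl u(1,3)] u(2) by blast
  have p: "comm_prod F ps \<in> carrier F" using ps(2) X by (intro comm_prod_closed) auto
  have "2 * length ps = card (set (pair_entries ps))"
    using ps(1) by (simp add: distinct_card length_pair_entries)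
  also have "\<dots> \<le> n" using card_mono[OF assms(4) ps(2)] assms(5) by simp
  finally have "2 * length ps \<le> n" .
  have N: "normal_closure F {comm_prod F ps} \<lhd> F"
    using p by (intro normal_closure_normal) auto
  have "F Mod normal_closure F {w} \<cong> F Mod normal_closure F {comm_prod F ps}"
    unfolding \<sigma>(2) using quotient_iso[OF assms(1,1) \<sigma>(1) p]
    by (rule group.iso_sym[OF normal.factorgroup_is_group[OF N]])
  also have "\<dots> \<cong> surface_group (length ps) \<star> free_group {1..n - 2 * length ps}"
    using comm_prod_quotient[OF assms(1,3,4) ps] assms(5) by simp
  finally show ?thesis using \<open>2 * length ps \<le> n\<close> by blast
qed

end
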